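(* Let $\mathbb{T}$ be the unit circle in $\mathbb{C}$ and let $$M=\{a:\mathbb{T}\to M_2(\mathbb{C})\text{ continuous} : a(\lambda)^t=a(\lambda)\text{ for all }\lambda\in\mathbb{T}\},$$ where $a(\lambda)^t$ denotes the transpose of $a(\lambda)$, regarded as a unital JB$^*$-algebra with the pointwise natural Jordan product $a\circ b=\frac12(ab+ba)$, pointwise involution and supremum norm. Let $w\in\mathcal{U}(M)$ be the unitary $w(\lambda)=\begin{pmatrix}\lambda&0\\0&1\end{pmatrix}$, let $\mathcal{U}^0(M)$ be the connected component of $\mathcal{U}(M)$ containing the unit, and let $\mathcal{U}^c(M)$ be the connected component of $\mathcal{U}(M)$ containing $w$. Then there exists no surjective isometry from $\mathcal{U}^0(M)$ onto $\mathcal{U}^c(M)$.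
   Context: $M_2(\mathbb{C})$ carries its C$^*$-norm and its adjoint as involution. $M$ is a norm-closed Jordan $^*$-subalgebra of the C$^*$-algebra $C(\mathbb{T},M_2(\mathbb{C}))$ containing its unit. An element $u$ of a unital JB$^*$-algebra with unit $\mathbf{1}$ is unitary if it is invertible in the Jordan sense (there is $u^{-1}$ with $u\circ u^{-1}=\mathbf{1}$ and $(u\circ u)\circ u^{-1}=u$) with $u^{-1}=u^*$; for the algebra $M$ above this means that $u(\lambda)$ is a unitary matrix for each $\lambda\in\mathbb{T}$. $\mathcal{U}(M)$ is the set of unitaries of $M$ with the metric given by the norm. An isometry between metric spaces is a distance-preserving map (no linearity assumed). *)

theory Defs
  imports "HOL-Analysis.Analysis"
begin

abbreviation circle :: "complex set" where
  "circle \<equiv> sphere 0 1"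

text \<open>The C*-norm of \<open>M\<^sub>2(\<complex>)\<close> is the operator norm for the Euclidean norm of \<open>\<complex>\<^sup>2\<close>. It is not the
  type class norm of \<^typ>\<open>complex^2^2\<close>, which is the Frobenius norm; both give the same topology,
  so \<^const>\<open>continuous_on\<close> may be used below.\<close>

definition cstar_norm :: "complex^2^2 \<Rightarrow> real" where
  "cstar_norm A = onorm (\<lambda>x. A *v x)"

definition mat_adjoint :: "complex^2^2 \<Rightarrow> complex^2^2" where
  "mat_adjoint A = (\<chi> i j. cnj (A $ j $ i))"

definition mat_jordan :: "complex^2^2 \<Rightarrow> complex^2^2 \<Rightarrow> complex^2^2" where
  "mat_jordan A B = (1/2) *\<^sub>R (A ** B + B ** A)"

text \<open>Functions on the circle are represented by functions on \<^typ>\<open>complex\<close> that are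
  \<^const>\<open>undefined\<close> off the circle, so that equality is equality on the circle.\<close>

type_synonym cmat_fun = "complex \<Rightarrow> complex^2^2"

definition M_alg :: "cmat_fun set" where
  "M_alg = {a \<in> extensional circle. continuous_on circle a \<and> (\<forall>z\<in>circle. transpose (a z) = a z)}"

definition M_unit :: cmat_fun where
  "M_unit = (\<lambda>z\<in>circle. mat 1)"

definition M_jordan :: "cmat_fun \<Rightarrow> cmat_fun \<Rightarrow> cmat_fun" where
  "M_jordan a b = (\<lambda>z\<in>circle. mat_jordan (a z) (b z))"

definition M_star :: "cmat_fun \<Rightarrow> cmat_fun" where
  "M_star a = (\<lambda>z\<in>circle. mat_adjoint (a z))"

definition sup_norm :: "cmat_fun \<Rightarrow> real" where
  "sup_norm a = (SUP z\<in>circle. cstar_norm (a z))"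

text \<open>The value off \<^const>\<open>M_alg\<close> is irrelevant, but \<^locale>\<open>Metric_space\<close> requires
  nonnegativity for all arguments, as in \<^const>\<open>Metric_space.fdist\<close>.\<close>

definition M_dist :: "cmat_fun \<Rightarrow> cmat_fun \<Rightarrow> real" where
  "M_dist a b = (if a \<in> M_alg \<and> b \<in> M_alg then sup_norm (\<lambda>z\<in>circle. a z - b z) else 0)"

definition M_jordan_inverse :: "cmat_fun \<Rightarrow> cmat_fun \<Rightarrow> bool" where
  "M_jordan_inverse u v \<longleftrightarrow>
     v \<in> M_alg \<and> M_jordan u v = M_unit \<and> M_jordan (M_jordan u u) v = u"

definition M_unitaries :: "cmat_fun set" where
  "M_unitaries = {u \<in> M_alg. M_jordan_inverse u (M_star u)}"

definition M_unitaries_top :: "cmat_fun topology" where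
  "M_unitaries_top = Metric_space.mtopology M_unitaries M_dist"

definition w_fun :: cmat_fun where
  "w_fun = (\<lambda>z\<in>circle. vector [vector [z, 0], vector [0, 1]])"

definition unitaries_component :: "cmat_fun \<Rightarrow> cmat_fun set" where
  "unitaries_component u = connected_component_of_set M_unitaries_top u"

definition surjective_isometry ::
    "('a \<Rightarrow> 'a \<Rightarrow> real) \<Rightarrow> 'a set \<Rightarrow> ('b \<Rightarrow> 'b \<Rightarrow> real) \<Rightarrow> 'b set \<Rightarrow> ('a \<Rightarrow> 'b) \<Rightarrow> bool" where
  "surjective_isometry d S d' T f \<longleftrightarrow>
     f ` S = T \<and> (\<forall>x\<in>S. \<forall>y\<in>S. d' (f x) (f y) = d x y)"


text \<open>\<^const>\<open>M_dist\<close> is a metric on \<^const>\<open>M_alg\<close>, hence on the unitaries.\<close>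

lemma cstar_norm_nonneg: "0 \<le> cstar_norm A"
  unfolding cstar_norm_def by (rule onorm_pos_le) simp

lemma cstar_norm_eq_0: "cstar_norm A = 0 \<longleftrightarrow> A = 0"
proof -
  have "cstar_norm A = 0 \<longleftrightarrow> (\<forall>x. A *v x = 0)"
    unfolding cstar_norm_def by (rule onorm_eq_0) simp
  also have "\<dots> \<longleftrightarrow> A = 0"
    by (metis matrix_eq matrix_vector_mult_0)
  finally show ?thesis .
qed

lemma cstar_norm_triangle: "cstar_norm (A + B) \<le> cstar_norm A + cstar_norm B"
proof -
  have "(\<lambda>x. (A + B) *v x) = (\<lambda>x. A *v x + B *v x)"
    by (simp add: matrix_vector_mult_add_rdistrib)
  then show ?thesis
    unfolding cstar_norm_def by (metis (no_types) onorm_triangle matrix_vector_mul_bounded_linear)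
qed

lemma cstar_norm_minus: "cstar_norm (- A) = cstar_norm A"
proof -
  have "(\<lambda>x. (- A) *v x) = (\<lambda>x. - (A *v x))"
    by (simp add: fun_eq_iff vec_eq_iff matrix_vector_mult_def sum_negf)
  then show ?thesis
    unfolding cstar_norm_def by (metis onorm_neg)
qed

lemma cstar_norm_le_norm: "\<exists>K. \<forall>A. cstar_norm A \<le> norm A * K"
proof -
  have "bilinear (\<lambda>(A::complex^2^2) x. A *v x)"
    unfolding bilinear_def
    by (auto intro!: linearI simp: sum.distrib algebra_simps
        vec_eq_iff matrix_vector_mult_def scaleR_sum_right)
  then have "bounded_bilinear (\<lambda>(A::complex^2^2) x. A *v x)"
    by (simp add: bilinear_conv_bounded_bilinear)
  then obtain K where K: "\<And>(A::complex^2^2) x. norm (A *v x) \<le> norm A * norm x * K"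
    using bounded_bilinear.bounded by blast
  have "cstar_norm A \<le> norm A * K" for A
    unfolding cstar_norm_def using K[of A] by (intro onorm_le) (simp add: mult_ac)
  then show ?thesis by blast
qed

lemma M_bdd:
  assumes "a \<in> M_alg" "b \<in> M_alg"
  shows "bdd_above ((\<lambda>z. cstar_norm (a z - b z)) ` circle)"
proof -
  obtain K where K: "\<And>A. cstar_norm A \<le> norm A * K"
    using cstar_norm_le_norm by blast
  have "continuous_on circle (\<lambda>z. a z - b z)"
    using assms by (intro continuous_intros) (auto simp: M_alg_def)
  then have "bounded ((\<lambda>z. a z - b z) ` circle)"
    by (intro compact_imp_bounded compact_continuous_image) auto
  then obtain B where B: "\<And>z. z \<in> circle \<Longrightarrow> norm (a z - b z) \<le> B"
    unfolding bounded_iff by blast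
  have "cstar_norm (a z - b z) \<le> B * \<bar>K\<bar>" if "z \<in> circle" for z
  proof -
    have "cstar_norm (a z - b z) \<le> norm (a z - b z) * \<bar>K\<bar>"
      by (rule order_trans[OF K]) (simp add: mult_left_mono)
    also have "\<dots> \<le> B * \<bar>K\<bar>"
      using B[OF that] by (rule mult_right_mono) simp
    finally show ?thesis .
  qed
  then show ?thesis by (intro bdd_aboveI2)
qed

lemma M_dist_eq:
  assumes "a \<in> M_alg" "b \<in> M_alg"
  shows "M_dist a b = (SUP z\<in>circle. cstar_norm (a z - b z))"
  using assms unfolding M_dist_def sup_norm_def by (auto intro!: SUP_cong)

lemma M_dist_upper:
  assumes "a \<in> M_alg" "b \<in> M_alg" "z \<in> circle"
  shows "cstar_norm (a z - b z) \<le> M_dist a b"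
  unfolding M_dist_eq[OF assms(1,2)] using assms M_bdd by (intro cSUP_upper) auto

lemma M_dist_nonneg: "0 \<le> M_dist a b"
proof (cases "a \<in> M_alg \<and> b \<in> M_alg")
  case True
  have "(1::complex) \<in> circle" by simp
  then show ?thesis
    using True M_dist_upper[of a b 1] cstar_norm_nonneg[of "a 1 - b 1"] by linarith
qed (auto simp: M_dist_def)

lemma circle_nonempty: "circle \<noteq> {}"
  by simp

lemma Metric_space_M_alg: "Metric_space M_alg M_dist"
proof
  show "0 \<le> M_dist a b" for a b
    by (rule M_dist_nonneg)
next
  fix a b :: cmat_fun
  have "cstar_norm (a z - b z) = cstar_norm (b z - a z)" for z
    using cstar_norm_minus[of "a z - b z"] by simp
  then show "M_dist a b = M_dist b a"
    by (cases "a \<in> M_alg \<and> b \<in> M_alg") (simp add: M_dist_eq, auto simp: M_dist_def)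
next
  fix a b assume ab: "a \<in> M_alg" "b \<in> M_alg"
  show "M_dist a b = 0 \<longleftrightarrow> a = b"
  proof
    assume "M_dist a b = 0"
    then have "a z = b z" if "z \<in> circle" for z
      using M_dist_upper[OF ab that] cstar_norm_nonneg[of "a z - b z"]
        cstar_norm_eq_0[of "a z - b z"] by simp
    then show "a = b"
      using ab by (intro extensionalityI[of _ circle]) (auto simp: M_alg_def)
  next
    assume "a = b"
    then show "M_dist a b = 0"
      using ab cstar_norm_eq_0[of 0] circle_nonempty by (simp add: M_dist_eq)
  qed
next
  fix a b c assume abc: "a \<in> M_alg" "b \<in> M_alg" "c \<in> M_alg"
  have "cstar_norm (a z - c z) \<le> M_dist a b + M_dist b c" if "z \<in> circle" for z
    using cstar_norm_triangle[of "a z - b z" "b z - c z"]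
      M_dist_upper[OF abc(1,2) that] M_dist_upper[OF abc(2,3) that] by simp
  then show "M_dist a c \<le> M_dist a b + M_dist b c"
    using abc circle_nonempty by (subst M_dist_eq[OF abc(1,3)]) (auto intro!: cSUP_least)
qed

lemma Metric_space_M_unitaries: "Metric_space M_unitaries M_dist"
  by (rule Metric_space.subspace[OF Metric_space_M_alg]) (auto simp: M_unitaries_def)

lemma topspace_M_unitaries_top: "topspace M_unitaries_top = M_unitaries"
  unfolding M_unitaries_top_def
  by (rule Metric_space.topspace_mtopology[OF Metric_space_M_unitaries])


text \<open>Both base points are unitaries, so their components are not empty.\<close>

lemma mat_jordan_entry:
  "mat_jordan A B $ i $ j =
     (A$i$1 * B$1$j + A$i$2 * B$2$j + (B$i$1 * A$1$j + B$i$2 * A$2$j)) / 2"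
  by (simp add: mat_jordan_def matrix_matrix_mult_def sum_2) (simp add: scaleR_conv_of_real)

lemma w_fun_in_M_unitaries: "w_fun \<in> M_unitaries"
proof -
  have cont: "continuous_on circle w_fun"
  proof -
    have "continuous_on circle (\<lambda>z. \<chi> i j. (vector [vector [z, 0], vector [0, 1]] :: complex^2^2) $ i $ j)"
    proof (intro continuous_on_vec_lambda)
      fix i j :: 2
      show "continuous_on circle (\<lambda>z. (vector [vector [z, 0], vector [0, 1]] :: complex^2^2) $ i $ j)"
        using exhaust_2[of i] exhaust_2[of j]
        by (elim disjE) (simp_all add: continuous_on_id continuous_on_const)
    qed
    then show ?thesis
      by (rule continuous_on_eq) (simp add: w_fun_def)
  qed
  have mem: "w_fun \<in> M_alg"
    using cont by (auto simp: M_alg_def w_fun_def transpose_def vec_eq_iff forall_2)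
  have cc: "z * cnj z = 1" "cnj z * z = 1" if "cmod z = 1" for z
    using that by (metis complex_norm_square mult.commute of_real_1 one_power2)+
  have "M_star w_fun \<in> M_alg"
  proof -
    have "continuous_on circle (\<lambda>z. mat_adjoint (w_fun z))"
      unfolding mat_adjoint_def using cont by (intro continuous_intros) auto
    then have "continuous_on circle (M_star w_fun)"
      by (rule continuous_on_eq) (simp add: M_star_def)
    then show ?thesis
      by (auto simp: M_alg_def M_star_def w_fun_def mat_adjoint_def transpose_def vec_eq_iff forall_2)
  qed
  moreover have "M_jordan w_fun (M_star w_fun) = M_unit"
    unfolding M_jordan_def M_unit_def M_star_def w_fun_def
    by (rule restrict_ext) (auto simp: vec_eq_iff forall_2 mat_jordan_entry mat_adjoint_def mat_def cc)
  moreover have "M_jordan (M_jordan w_fun w_fun) (M_star w_fun) = w_fun"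
    unfolding M_jordan_def M_unit_def M_star_def w_fun_def
    by (rule restrict_ext) (auto simp: vec_eq_iff forall_2 mat_jordan_entry mat_adjoint_def mat_def cc mult.assoc)
  ultimately show ?thesis
    using mem by (simp add: M_unitaries_def M_jordan_inverse_def)
qed

lemma M_unit_in_M_unitaries: "M_unit \<in> M_unitaries"
proof -
  have "continuous_on circle M_unit"
    by (rule continuous_on_eq[OF continuous_on_const[of _ "mat 1"]]) (simp add: M_unit_def)
  then have mem: "M_unit \<in> M_alg"
    by (auto simp: M_alg_def M_unit_def)
  have star: "M_star M_unit = M_unit"
    unfolding M_star_def M_unit_def
    by (rule restrict_ext) (auto simp: vec_eq_iff forall_2 mat_adjoint_def mat_def)
  have "M_jordan M_unit M_unit = M_unit"
    unfolding M_jordan_def M_unit_def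
    by (rule restrict_ext) (auto simp: vec_eq_iff forall_2 mat_jordan_entry mat_def)
  then show ?thesis
    using mem star by (simp add: M_unitaries_def M_jordan_inverse_def)
qed

end

(*
  Let r = |exp(i pi/6) - 1|. In the unitaries, exp(i pi/6) u is the only point within r of both u
  and exp(i pi/3) u. Conversely, if y1 is the only point within r of both y0 and y2 and
  ||y0 - y2|| <= 1, then y0 + y2 = sqrt 3 y1: the pointwise square root z of y0* y2 gives such a
  point y0 z, and unless z + z* = sqrt 3, multiplying z by a Cayley transform gives another one.
  A surjective isometry D between two components therefore turns the points exp(i k pi/6) u into
  a sequence with y_k + y_(k+2) = sqrt 3 y_(k+1), so y_6 = - y_0, that is, D(-u) = -D(u). Hence D
  preserves the relation u*v + v*u = 0, which says ||u - v||, ||-u - v|| <= sqrt 2.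

  The component of 1 contains three mutually orthogonal elements for this relation: 1 and two
  constants. If a, b, c are three such elements, then b a* c is antisymmetric, so
  det(b) det(a)^(-1) det(c) has a continuous square root on the circle. On the component of w
  every determinant has odd winding number, so this is impossible there.
*)

theory Submission
  imports Defs
begin

section \<open>Unitary 2x2 matrices\<close>

definition diag2 :: "complex \<Rightarrow> complex \<Rightarrow> complex^2^2" where
  "diag2 a b = (\<chi> i j. if i = j then (if i = 1 then a else b) else 0)"

definition mat_scale :: "complex \<Rightarrow> complex^2^2 \<Rightarrow> complex^2^2" where
  "mat_scale c A = (\<chi> i j. c * A $ i $ j)"

definition adjugate2 :: "complex^2^2 \<Rightarrow> complex^2^2" where
  "adjugate2 A = mat (trace A) - A"

definition unitary_mat :: "complex^2^2 \<Rightarrow> bool" where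
  "unitary_mat A \<longleftrightarrow> mat_adjoint A ** A = mat 1"

lemma diag2_nth [simp]:
  "diag2 a b $ 1 $ 1 = a" "diag2 a b $ 1 $ 2 = 0" "diag2 a b $ 2 $ 1 = 0" "diag2 a b $ 2 $ 2 = b"
  by (simp_all add: diag2_def)

lemma mat_scale_nth [simp]: "mat_scale c A $ i $ j = c * A $ i $ j"
  by (simp add: mat_scale_def)

lemma mat_adjoint_nth [simp]: "mat_adjoint A $ i $ j = cnj (A $ j $ i)"
  by (simp add: mat_adjoint_def)

lemma mat_mult_nth: "((A :: complex^2^2) ** B) $ i $ j = A$i$1 * B$1$j + A$i$2 * B$2$j"
  by (simp add: matrix_matrix_mult_def sum_2)

lemma mat_2_nth [simp]:
  "(mat c :: complex^2^2) $ 1 $ 1 = c" "(mat c :: complex^2^2) $ 1 $ 2 = 0"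
  "(mat c :: complex^2^2) $ 2 $ 1 = 0" "(mat c :: complex^2^2) $ 2 $ 2 = c"
  by (simp_all add: mat_def)

lemma trace_2: "trace (A :: complex^2^2) = A$1$1 + A$2$2"
  by (simp add: trace_def sum_2)

lemmas mat2_simps = vec_eq_iff forall_2 mat_mult_nth

lemma mat_adjoint_mult: "mat_adjoint (A ** B) = mat_adjoint B ** mat_adjoint A"
  by (simp add: mat2_simps mult.commute)

lemma mat_adjoint_adjoint [simp]: "mat_adjoint (mat_adjoint A) = A"
  by (simp add: mat2_simps)

lemma mat_adjoint_diag2 [simp]: "mat_adjoint (diag2 a b) = diag2 (cnj a) (cnj b)"
  by (simp add: mat2_simps)

lemma diag2_mult: "diag2 a b ** diag2 c d = diag2 (a * c) (b * d)"
  by (simp add: mat2_simps)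

lemma diag2_one: "diag2 c c = mat c"
  by (simp add: mat2_simps)

lemma unitary_mat_right: "unitary_mat A \<Longrightarrow> A ** mat_adjoint A = mat 1"
  unfolding unitary_mat_def using matrix_left_right_inverse by blast

lemma unitary_mat_adjoint: "unitary_mat A \<Longrightarrow> unitary_mat (mat_adjoint A)"
  by (simp add: unitary_mat_def[of "mat_adjoint A"] unitary_mat_right)

lemma unitary_mat_mult: "unitary_mat A \<Longrightarrow> unitary_mat B \<Longrightarrow> unitary_mat (A ** B)"
  unfolding unitary_mat_def mat_adjoint_mult
  by (metis matrix_mul_assoc matrix_mul_lid)

lemma unitary_mat_diag2: "unitary_mat (diag2 a b) \<longleftrightarrow> cmod a = 1 \<and> cmod b = 1"
proof -
  have "cnj z * z = 1 \<longleftrightarrow> cmod z = 1" for z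
    by (metis complex_norm_square mult.commute norm_ge_zero norm_one of_real_1 of_real_eq_iff
        one_power2 power2_eq_1_iff power2_eq_imp_eq zero_le_one)
  then show ?thesis
    by (simp add: unitary_mat_def mat2_simps)
qed

lemma unitary_mat_cancel_left:
  "unitary_mat A \<Longrightarrow> mat_adjoint A ** (A ** B) = B" "unitary_mat A \<Longrightarrow> A ** (mat_adjoint A ** B) = B"
  by (simp_all add: matrix_mul_assoc unitary_mat_right) (simp add: unitary_mat_def)

lemma unitary_mat_cancel_right:
  "unitary_mat A \<Longrightarrow> (B ** A) ** mat_adjoint A = B" "unitary_mat A \<Longrightarrow> (B ** mat_adjoint A) ** A = B"
  by (simp_all add: matrix_mul_assoc[symmetric] unitary_mat_right) (simp add: unitary_mat_def)

section \<open>Unitary invariance of the operator norm\<close>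

lemma norm_vec_2: "(norm (x :: complex^2))\<^sup>2 = (cmod (x$1))\<^sup>2 + (cmod (x$2))\<^sup>2"
  by (simp add: norm_vec_def L2_set_def sum_2)

lemma norm_unitary_mat_mult:
  assumes "unitary_mat A"
  shows "norm (A *v x) = norm x"
proof -
  have *: "complex_of_real ((norm (y :: complex^2))\<^sup>2) = cnj (y$1) * y$1 + cnj (y$2) * y$2" for y
    unfolding norm_vec_2 of_real_add by (simp only: complex_norm_square mult.commute)
  have A: "cnj (A$1$1) * A$1$1 + cnj (A$2$1) * A$2$1 = 1" "cnj (A$1$1) * A$1$2 + cnj (A$2$1) * A$2$2 = 0"
    "cnj (A$1$2) * A$1$1 + cnj (A$2$2) * A$2$1 = 0" "cnj (A$1$2) * A$1$2 + cnj (A$2$2) * A$2$2 = 1"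
    using assms by (simp_all add: unitary_mat_def mat2_simps)
  have "complex_of_real ((norm (A *v x))\<^sup>2) = complex_of_real ((norm x)\<^sup>2)"
    unfolding * matrix_vector_mult_def
    by (simp add: sum_2) (use A in algebra)
  then show ?thesis
    by (simp only: of_real_eq_iff) simp
qed

lemma cstar_norm_unitary_left:
  assumes "unitary_mat A"
  shows "cstar_norm (A ** B) = cstar_norm B"
proof -
  have "norm ((A ** B) *v x) = norm (B *v x)" for x
    by (simp add: matrix_vector_mul_assoc[symmetric] norm_unitary_mat_mult[OF assms])
  then show ?thesis
    by (simp add: cstar_norm_def onorm_def)
qed

text \<open>Since \<open>A\<close> preserves the norms of the vectors passed on to \<open>B\<close>,
  the operator norm cannot grow; the same bound for the adjoint of \<open>A\<close> gives
  equality.\<close>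

lemma cstar_norm_unitary_right:
  assumes "unitary_mat A"
  shows "cstar_norm (B ** A) = cstar_norm B"
proof -
  have le: "cstar_norm (C ** D) \<le> cstar_norm C" if "unitary_mat D" for C D :: "complex^2^2"
    unfolding cstar_norm_def
  proof (rule onorm_bound)
    show "0 \<le> onorm ((*v) C)" by (rule onorm_pos_le) simp
    show "norm ((C ** D) *v x) \<le> onorm ((*v) C) * norm x" for x
      using onorm[of "(*v) C" "D *v x"] norm_unitary_mat_mult[OF that]
      by (simp add: matrix_vector_mul_assoc)
  qed
  show ?thesis
    using le[OF assms, of B] le[OF unitary_mat_adjoint[OF assms], of "B ** A"]
    by (simp add: unitary_mat_cancel_right[OF assms])
qed

lemma cstar_norm_diag2: "cstar_norm (diag2 a b) = max (cmod a) (cmod b)"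
proof (rule antisym)
  show "cstar_norm (diag2 a b) \<le> max (cmod a) (cmod b)"
    unfolding cstar_norm_def
  proof (rule onorm_bound)
    fix x :: "complex^2"
    have "(norm (diag2 a b *v x))\<^sup>2 = (cmod a * cmod (x$1))\<^sup>2 + (cmod b * cmod (x$2))\<^sup>2"
      by (simp add: norm_vec_2 matrix_vector_mult_def sum_2 norm_mult)
    also have "\<dots> \<le> (max (cmod a) (cmod b) * cmod (x$1))\<^sup>2 + (max (cmod a) (cmod b) * cmod (x$2))\<^sup>2"
      by (intro add_mono power_mono mult_right_mono) auto
    also have "\<dots> = (max (cmod a) (cmod b) * norm x)\<^sup>2"
      by (simp only: power_mult_distrib norm_vec_2 distrib_left)
    finally show "norm (diag2 a b *v x) \<le> max (cmod a) (cmod b) * norm x"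
      by (rule power2_le_imp_le) (simp add: le_max_iff_disj)
  qed (simp add: le_max_iff_disj)
  \<comment> \<open>The images of the two basis vectors give the lower bound.\<close>
  have "cmod (diag2 a b $ i $ i) \<le> cstar_norm (diag2 a b)" for i
  proof -
    have "cmod (diag2 a b $ i $ i) = norm (diag2 a b *v axis i 1)"
      using exhaust_2[of i]
      by (subst power_eq_iff_eq_base[of 2, symmetric])
        (auto simp: norm_vec_2 matrix_vector_mult_def sum_2 axis_def)
    also have "\<dots> \<le> cstar_norm (diag2 a b) * norm (axis i 1 :: complex^2)"
      unfolding cstar_norm_def by (rule onorm) simp
    finally show ?thesis by simp
  qed
  from this[of 1] this[of 2] show "max (cmod a) (cmod b) \<le> cstar_norm (diag2 a b)"
    by simp
qed

section \<open>Simultaneous diagonalization of two unitary matrices\<close>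

lemma unitary_mat_diagonalization:
  assumes W: "unitary_mat W"
  obtains Q a b where "unitary_mat Q" "cmod a = 1" "cmod b = 1" "W = Q ** diag2 a b ** mat_adjoint Q"
proof -
  \<comment> \<open>A root of the characteristic polynomial, by the quadratic formula.\<close>
  define a where "a = (trace W + csqrt ((trace W)\<^sup>2 - 4 * det W)) / 2"
  have "a\<^sup>2 - trace W * a + det W = 0"
    using power2_csqrt[of "(trace W)\<^sup>2 - 4 * det W"] unfolding a_def
    by (simp add: power2_eq_square field_simps) algebra
  then have "det (W - mat a) = 0"
    by (simp add: det_2 trace_2 power2_eq_square algebra_simps)
  then have "\<not> invertible (W - mat a)"
    by (simp add: invertible_det_nz)
  then obtain x where x: "(W - mat a) *v x = 0" "x \<noteq> 0"
    using invertible_left_inverse matrix_left_invertible_ker by blast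
  define n where "n = norm x"
  define e1 e2 where "e1 = x$1 / n" and "e2 = x$2 / n"
  have n: "n \<noteq> 0"
    using x by (simp add: n_def)
  have e: "cnj e1 * e1 + cnj e2 * e2 = 1"
  proof -
    have n2: "cnj (x$1) * x$1 + cnj (x$2) * x$2 = complex_of_real (n\<^sup>2)"
      unfolding n_def norm_vec_2 of_real_add by (simp only: complex_norm_square mult.commute)
    have "cnj e1 * e1 + cnj e2 * e2 = (cnj (x$1) * x$1 + cnj (x$2) * x$2) / complex_of_real (n\<^sup>2)"
      by (simp add: e1_def e2_def add_divide_distrib power2_eq_square)
    then show ?thesis
      unfolding n2 using n by simp
  qed
  have "W$1$1 * x$1 + W$1$2 * x$2 = a * x$1" "W$2$1 * x$1 + W$2$2 * x$2 = a * x$2"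
    using x(1) by (simp_all add: vec_eq_iff forall_2 matrix_vector_mult_def sum_2 algebra_simps)
  then have We: "W$1$1 * e1 + W$1$2 * e2 = a * e1" "W$2$1 * e1 + W$2$2 * e2 = a * e2"
    unfolding e1_def e2_def by (simp_all flip: add_divide_distrib)
  \<comment> \<open>The first column is the unit eigenvector, the second a unit vector orthogonal to
    it, so conjugation by \<open>Q\<close> makes \<open>W\<close> upper triangular.\<close>
  define Q :: "complex^2^2" where "Q = vector [vector [e1, - cnj e2], vector [e2, cnj e1]]"
  have Q: "unitary_mat Q"
    using e unfolding unitary_mat_def mat2_simps by (simp add: Q_def) algebra
  define D where "D = mat_adjoint Q ** W ** Q"
  have uD: "unitary_mat D"
    unfolding D_def by (intro unitary_mat_mult unitary_mat_adjoint Q W)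
  have D11: "D$1$1 = a" and D21: "D$2$1 = 0"
    unfolding D_def mat_mult_nth using e We by (simp_all add: Q_def; algebra)+
  have "cnj (D$1$1) * D$1$1 + cnj (D$2$1) * D$2$1 = 1" "cnj (D$1$1) * D$1$2 + cnj (D$2$1) * D$2$2 = 0"
    using uD by (simp_all add: unitary_mat_def mat2_simps)
  \<comment> \<open>A triangular unitary matrix is diagonal: the columns are orthogonal, and the
    only nonzero entry of the first is the diagonal one.\<close>
  then have "D$1$2 = 0"
    using D21 by auto
  then have D: "D = diag2 a (D$2$2)"
    using D11 D21 by (simp add: vec_eq_iff forall_2)
  then have "cmod a = 1" "cmod (D$2$2) = 1"
    using uD unitary_mat_diag2[of a "D$2$2"] by simp_all
  moreover have "W = Q ** D ** mat_adjoint Q"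
    unfolding D_def by (simp add: matrix_mul_assoc[symmetric] unitary_mat_cancel_left[OF Q] unitary_mat_right[OF Q])
  ultimately show thesis
    using that Q D by metis
qed

text \<open>Diagonalizing U* V with \<open>Q\<close> absorbed on both sides reduces a pair to the
  two scalars \<open>a\<close>, \<open>b\<close>. Every matrix built later from the pair has the
  form \<open>P ** diag2 c d ** Q\<close> with these \<open>P\<close>, \<open>Q\<close>, so
  distances and products are computed on eigenvalues.\<close>

lemma unitary_mat_pair:
  assumes U: "unitary_mat U" and V: "unitary_mat V"
  obtains P Q a b where "unitary_mat P" "unitary_mat Q" "cmod a = 1" "cmod b = 1"
    "U = P ** Q" "V = P ** diag2 a b ** Q"
proof -
  obtain Q a b where Q: "unitary_mat Q" "cmod a = 1" "cmod b = 1"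
    "mat_adjoint U ** V = Q ** diag2 a b ** mat_adjoint Q"
    using unitary_mat_diagonalization[OF unitary_mat_mult[OF unitary_mat_adjoint[OF U] V]] by metis
  have "U = (U ** Q) ** mat_adjoint Q"
    by (simp add: unitary_mat_cancel_right Q(1))
  moreover have "V = (U ** Q) ** diag2 a b ** mat_adjoint Q"
    using arg_cong[OF Q(4), of "\<lambda>X. U ** X"] by (simp add: unitary_mat_cancel_left U matrix_mul_assoc)
      (metis U matrix_mul_assoc unitary_mat_cancel_left(2))
  ultimately show thesis
    using that[of "U ** Q" "mat_adjoint Q" a b] Q(1-3) U by (simp add: unitary_mat_mult unitary_mat_adjoint)
qed

lemma cstar_norm_unitary_diag2:
  "unitary_mat P \<Longrightarrow> unitary_mat Q \<Longrightarrow> cstar_norm (P ** diag2 a b ** Q) = max (cmod a) (cmod b)"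
  by (simp add: cstar_norm_unitary_left cstar_norm_unitary_right cstar_norm_diag2)

lemma diag2_sandwich_linear:
  "P ** diag2 a b ** Q + P ** diag2 c d ** Q = P ** diag2 (a + c) (b + d) ** Q"
  "P ** diag2 a b ** Q - P ** diag2 c d ** Q = P ** diag2 (a - c) (b - d) ** Q"
  "mat_scale s (P ** diag2 a b ** Q) = P ** diag2 (s * a) (s * b) ** Q"
  by (simp_all add: mat2_simps algebra_simps)

lemma diag2_sandwich_mult:
  assumes "unitary_mat Q"
  shows "(P ** diag2 a b ** Q) ** (mat_adjoint Q ** diag2 c d ** R) = P ** diag2 (a * c) (b * d) ** R"
  by (metis (no_types, lifting) assms diag2_mult matrix_mul_assoc unitary_mat_cancel_left(2))

section \<open>The metric space of unitaries\<close>

lemma continuous_on_matI: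
  assumes "\<And>i j. continuous_on S (\<lambda>x. f x $ i $ j)"
  shows "continuous_on S (f :: _ \<Rightarrow> complex^2^2)"
  using continuous_on_vec_lambda[of S "\<lambda>i x. f x $ i"] continuous_on_vec_lambda[of S "\<lambda>j x. f x $ _ $ j"] assms
  by (simp add: vec_lambda_eta)

lemma continuous_on_mat_mult [continuous_intros]:
  fixes f g :: "'a::topological_space \<Rightarrow> complex^2^2"
  assumes "continuous_on S f" "continuous_on S g"
  shows "continuous_on S (\<lambda>x. f x ** g x)"
  by (rule continuous_on_matI) (use assms in \<open>simp add: mat_mult_nth; intro continuous_intros\<close>)

lemma continuous_on_mat_adjoint [continuous_intros]:
  assumes "continuous_on S f"
  shows "continuous_on S (\<lambda>x. mat_adjoint (f x))"
  by (rule continuous_on_matI) (use assms in \<open>simp; intro continuous_intros\<close>)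

lemma continuous_on_mat_scale [continuous_intros]:
  assumes "continuous_on S f" "continuous_on S g"
  shows "continuous_on S (\<lambda>x. mat_scale (f x) (g x))"
  by (rule continuous_on_matI) (use assms in \<open>simp; intro continuous_intros\<close>)

lemma continuous_on_mat [continuous_intros]:
  assumes "continuous_on S f"
  shows "continuous_on S (\<lambda>x. mat (f x) :: complex^2^2)"
proof (rule continuous_on_matI)
  show "continuous_on S (\<lambda>x. (mat (f x) :: complex^2^2) $ i $ j)" for i j
    using assms by (cases "i = j") (simp_all add: mat_def)
qed

lemma continuous_on_trace2 [continuous_intros]:
  assumes "continuous_on S f"
  shows "continuous_on S (\<lambda>x. trace (f x :: complex^2^2))"
  unfolding trace_2 by (intro continuous_intros assms)

lemma continuous_on_det2 [continuous_intros]: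
  assumes "continuous_on S f"
  shows "continuous_on S (\<lambda>x. det (f x :: complex^2^2))"
  unfolding det_2 by (intro continuous_intros assms)

section \<open>Jordan unitaries as continuous functions with symmetric unitary values\<close>

lemma M_unitariesI:
  assumes "continuous_on circle u" "\<And>z. z \<in> circle \<Longrightarrow> transpose (u z) = u z"
    "\<And>z. z \<in> circle \<Longrightarrow> unitary_mat (u z)"
  shows "restrict u circle \<in> M_unitaries"
proof -
  have u: "restrict u circle \<in> M_alg"
    using assms(1,2) continuous_on_eq[OF assms(1), of "restrict u circle"] by (auto simp: M_alg_def)
  have "continuous_on circle (M_star (restrict u circle))"
    by (rule continuous_on_eq[of _ "\<lambda>z. mat_adjoint (u z)"])
      (auto simp: M_star_def intro!: continuous_intros assms)
  moreover have "transpose (mat_adjoint A) = mat_adjoint A" if "transpose A = A" for A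
    using that by (simp add: vec_eq_iff transpose_def)
  ultimately have "M_star (restrict u circle) \<in> M_alg"
    using assms(2) by (simp add: M_alg_def) (simp add: M_star_def)
  moreover have "mat_jordan A (mat_adjoint A) = mat 1" "mat_jordan (mat_jordan A A) (mat_adjoint A) = A"
    if A: "unitary_mat A" for A
  proof -
    have half: "(1/2) *\<^sub>R (X + X) = X" for X :: "complex^2^2"
      by (simp add: scaleR_2[symmetric])
    show "mat_jordan A (mat_adjoint A) = mat 1"
      using A by (simp add: mat_jordan_def unitary_mat_right half) (simp add: unitary_mat_def half)
    have "mat_jordan A A = A ** A"
      by (simp add: mat_jordan_def half)
    then show "mat_jordan (mat_jordan A A) (mat_adjoint A) = A"
      using A by (simp add: mat_jordan_def unitary_mat_cancel_left unitary_mat_cancel_right half)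
  qed
  ultimately show ?thesis
    using u assms(3) unfolding M_unitaries_def M_jordan_inverse_def
    by (auto simp: M_jordan_def M_star_def M_unit_def intro!: ext)
qed

text \<open>The two Jordan identities make A A* and A* A idempotents with sum 2, which forces both
  to be the identity.\<close>

lemma unitary_mat_of_jordan_inverse:
  assumes "mat_jordan A (mat_adjoint A) = mat 1" "mat_jordan (mat_jordan A A) (mat_adjoint A) = A"
  shows "unitary_mat A"
proof -
  define P R where "P = A ** mat_adjoint A" and "R = mat_adjoint A ** A"
  have dbl: "X + Y = 2 *\<^sub>R Z" if "(1/2) *\<^sub>R (X + Y) = Z" for X Y Z :: "complex^2^2"
    using that by auto
  have PR: "P + R = 2 *\<^sub>R mat 1"
    unfolding P_def R_def using assms(1) by (intro dbl) (simp add: mat_jordan_def)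
  have AA: "mat_jordan A A = A ** A"
    by (simp add: mat_jordan_def scaleR_2[symmetric])
  have 1: "A ** P + R ** A = 2 *\<^sub>R A"
    using dbl[of "(A ** A) ** mat_adjoint A" "mat_adjoint A ** (A ** A)" A] assms(2)
    unfolding AA by (simp add: mat_jordan_def P_def R_def matrix_mul_assoc)
  have 2: "A ** R = P ** A"
    by (simp add: P_def R_def matrix_mul_assoc)
  have P: "P = 2 *\<^sub>R mat 1 - R"
    using PR by (metis add_diff_cancel_right')
  have 3: "A ** P = 2 *\<^sub>R A - A ** R" "P ** A = 2 *\<^sub>R A - R ** A"
    unfolding P by (simp_all add: mat2_simps scaleR_conv_of_real algebra_simps)
  \<comment> \<open>Substituting P = 2 - R into \<open>1\<close> shows that \<open>R\<close>
    commutes with \<open>A\<close>; with \<open>2\<close> this gives A R = A.\<close>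
  have "R ** A = A ** R"
    using 1 unfolding 3(1) by (simp add: diff_add_eq diff_eq_eq)
  then have "A ** R + A ** R = 2 *\<^sub>R A"
    using 2 unfolding 3(2) by (metis eq_diff_eq)
  then have AR: "A ** R = A"
    by (simp add: scaleR_2[symmetric])
  then have RR: "R ** R = R"
    by (metis R_def matrix_mul_assoc)
  have "P ** P = P"
    by (metis AR P_def R_def matrix_mul_assoc)
  \<comment> \<open>Expanding the square of 2 - R with R R = R turns P P = P into a linear equation
    for \<open>R\<close>.\<close>
  moreover have "P ** P = 4 *\<^sub>R mat 1 - 4 *\<^sub>R R + R ** R"
    unfolding P by (simp add: mat2_simps scaleR_conv_of_real algebra_simps)
  ultimately have "4 *\<^sub>R mat 1 - 4 *\<^sub>R R + R = 2 *\<^sub>R mat 1 - R"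
    unfolding RR using P by simp
  then have "(4 *\<^sub>R mat 1 - 4 *\<^sub>R R + R) $ i $ j = (2 *\<^sub>R mat 1 - R) $ i $ j" for i j
    by (rule arg_cong[of _ _ "\<lambda>A. A $ i $ j"])
  then have "R = mat 1"
    by (simp add: vec_eq_iff scaleR_conv_of_real algebra_simps)
  then show ?thesis
    by (simp add: unitary_mat_def R_def)
qed

lemma M_unitariesD:
  assumes "u \<in> M_unitaries"
  shows "u \<in> M_alg" "continuous_on circle u"
    "z \<in> circle \<Longrightarrow> transpose (u z) = u z" "z \<in> circle \<Longrightarrow> unitary_mat (u z)"
proof -
  show u: "u \<in> M_alg" "continuous_on circle u"
    "z \<in> circle \<Longrightarrow> transpose (u z) = u z"
    using assms by (auto simp: M_unitaries_def M_alg_def)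
  assume z: "z \<in> circle"
  have *: "M_jordan u (M_star u) = M_unit" "M_jordan (M_jordan u u) (M_star u) = u"
    using assms by (auto simp: M_unitaries_def M_jordan_inverse_def)
  show "unitary_mat (u z)"
    using z fun_cong[OF *(1), of z] fun_cong[OF *(2), of z]
    by (intro unitary_mat_of_jordan_inverse) (simp_all add: M_jordan_def M_star_def M_unit_def)
qed

lemma M_dist_le_iff:
  assumes "u \<in> M_alg" "v \<in> M_alg"
  shows "M_dist u v \<le> r \<longleftrightarrow> (\<forall>z\<in>circle. cstar_norm (u z - v z) \<le> r)"
  unfolding M_dist_eq[OF assms] using assms M_bdd circle_nonempty by (intro cSUP_le_iff) auto

lemma M_unitaries_eqI:
  assumes "u \<in> M_unitaries" "v \<in> M_unitaries" "\<And>z. z \<in> circle \<Longrightarrow> u z = v z"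
  shows "u = v"
  using assms by (intro extensionalityI[of _ circle]) (auto simp: M_unitaries_def M_alg_def)

text \<open>\<open>N (N\<^sup>*)\<^sup>-\<^sup>1\<close>, which is unitary for normal invertible \<open>N\<close>; the adjugate
  makes continuity in \<open>N\<close> evident.\<close>

definition cayley :: "complex^2^2 \<Rightarrow> complex^2^2" where
  "cayley N = mat_scale (1 / det (mat_adjoint N)) (N ** adjugate2 (mat_adjoint N))"

lemma continuous_on_cayley:
  assumes "continuous_on S N" "\<And>x. x \<in> S \<Longrightarrow> det (N x) \<noteq> 0"
  shows "continuous_on S (\<lambda>x. cayley (N x))"
proof -
  have "det (mat_adjoint A) = cnj (det A)" for A
    by (simp add: det_2 mult.commute)
  then show ?thesis
    unfolding cayley_def adjugate2_def using assms by (intro continuous_intros) auto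
qed

section \<open>Functions of a matrix in a diagonalizing basis\<close>

lemma mat_conj_diag2:
  assumes "unitary_mat Q"
  shows "mat c = mat_adjoint Q ** diag2 c c ** Q"
proof -
  have "mat_adjoint Q ** diag2 c c ** Q = mat_scale c (mat_adjoint Q ** Q)"
    by (simp add: mat2_simps algebra_simps)
  also have "\<dots> = mat c"
    using assms by (simp add: unitary_mat_def) (simp add: mat2_simps)
  finally show ?thesis ..
qed

lemma mat_adjoint_conj_diag2:
  "mat_adjoint (mat_adjoint Q ** diag2 a b ** Q) = mat_adjoint Q ** diag2 (cnj a) (cnj b) ** Q"
  by (simp add: mat_adjoint_mult matrix_mul_assoc)

lemma trace_conj_diag2:
  assumes "unitary_mat Q"
  shows "trace (mat_adjoint Q ** diag2 a b ** Q) = a + b"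
proof -
  have "trace (mat_adjoint Q ** diag2 a b ** Q) = trace (diag2 a b ** (Q ** mat_adjoint Q))"
    by (metis matrix_mul_assoc trace_mul_sym)
  then show ?thesis
    by (simp add: unitary_mat_right[OF assms] trace_2)
qed

lemma det_conj_diag2:
  assumes "unitary_mat Q"
  shows "det (mat_adjoint Q ** diag2 a b ** Q) = a * b"
proof -
  have "det (mat_adjoint Q) * det Q = 1"
    using assms by (metis det_I det_mul unitary_mat_def)
  moreover have "det (diag2 a b) = a * b"
    by (simp add: det_2)
  ultimately show ?thesis
    by (simp add: det_mul)
qed

lemma cayley_conj_diag2:
  assumes Q: "unitary_mat Q" and "a \<noteq> 0" "b \<noteq> 0"
  shows "cayley (mat_adjoint Q ** diag2 a b ** Q) = mat_adjoint Q ** diag2 (a / cnj a) (b / cnj b) ** Q"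
proof -
  \<comment> \<open>Trace minus matrix exchanges the two eigenvalues, so dividing by the determinant
    inverts each of them.\<close>
  have "adjugate2 (mat_adjoint Q ** diag2 (cnj a) (cnj b) ** Q) = mat_adjoint Q ** diag2 (cnj b) (cnj a) ** Q"
    unfolding adjugate2_def trace_conj_diag2[OF Q]
    by (subst mat_conj_diag2[OF Q]) (simp add: diag2_sandwich_linear)
  then show ?thesis
    unfolding cayley_def mat_adjoint_conj_diag2 det_conj_diag2[OF Q]
    using assms by (simp add: diag2_sandwich_mult diag2_sandwich_linear)
qed

lemma sandwich_one: "(P :: complex^2^2) ** Q = P ** diag2 1 1 ** Q"
  by (simp add: diag2_one)

text \<open>A function of at most two eigenvalues is interpolated by an affine one, so the matrix is
  a linear combination of two symmetric matrices. The condition for \<open>a = b\<close> says that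
  (c, d) arises from (a, b) by a function. This keeps all later constructions inside the symmetric
  matrices.\<close>

lemma transpose_diag2_sandwich:
  fixes P Q :: "complex^2^2"
  assumes U: "transpose (P ** Q) = P ** Q"
    and V: "transpose (P ** diag2 a b ** Q) = P ** diag2 a b ** Q" and "a = b \<Longrightarrow> c = d"
  shows "transpose (P ** diag2 c d ** Q) = P ** diag2 c d ** Q"
proof -
  obtain s t where "c = s + t * a" "d = s + t * b"
  proof (cases "a = b")
    case True
    then have "c = d"
      by (rule assms(3))
    then show ?thesis
      by (intro that[of c 0]) simp_all
  next
    case False
    define t where "t = (c - d) / (a - b)"
    have "t * (a - b) = c - d"
      using False by (simp add: t_def)
    then have "d = c - t * a + t * b"
      by algebra
    then show ?thesis
      using that[of "c - t * a" t] by simp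
  qed
  then have *: "P ** diag2 c d ** Q = mat_scale s (P ** Q) + mat_scale t (P ** diag2 a b ** Q)"
    unfolding sandwich_one[of P Q] by (simp add: diag2_sandwich_linear)
  have "transpose (mat_scale s A + mat_scale t B) = mat_scale s (transpose A) + mat_scale t (transpose B)" for A B
    by (simp add: vec_eq_iff transpose_def)
  then show ?thesis
    unfolding * by (simp only: U V)
qed

section \<open>Paths of unitaries\<close>

lemma homotopic_unitaries_connected:
  assumes cont: "continuous_on ({0..1::real} \<times> circle) (\<lambda>(t, z). H t z)"
    and H: "\<And>t. t \<in> {0..1} \<Longrightarrow> restrict (H t) circle \<in> M_unitaries"
  shows "connected_component_of M_unitaries_top (restrict (H 0) circle) (restrict (H 1) circle)"
proof -
  interpret Metric_space M_unitaries M_dist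
    by (rule Metric_space_M_unitaries)
  let ?h = "\<lambda>t. restrict (H t) circle"
  obtain K where K: "\<And>A. cstar_norm A \<le> norm A * K"
    using cstar_norm_le_norm by blast
  \<comment> \<open>Compactness of the product makes continuity in \<open>t\<close> uniform over the
    circle, which is continuity for the supremum norm.\<close>
  have "uniformly_continuous_on ({0..1} \<times> circle) (\<lambda>(t, z). H t z)"
    by (intro compact_uniformly_continuous cont compact_Times) auto
  note uc = this[unfolded uniformly_continuous_on_def, rule_format]
  have "continuous_map (top_of_set {0..1}) mtopology ?h"
    unfolding continuous_map_to_metric
  proof (intro ballI allI impI)
    fix s e :: real assume s: "s \<in> topspace (top_of_set {0..1})" and e: "e > 0"
    \<comment> \<open>\<open>K\<close> converts the Frobenius norm to the operator norm; adding 1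
      avoids division by zero, and the factor 2 keeps the supremum strictly below
      \<open>e\<close>.\<close>
    define e' where "e' = e / (2 * (\<bar>K\<bar> + 1))"
    have "e' > 0"
      using e by (simp add: e'_def add_nonneg_pos)
    then obtain d where d: "d > 0" "\<And>p q. p \<in> {0..1} \<times> circle \<Longrightarrow> q \<in> {0..1} \<times> circle \<Longrightarrow>
      dist q p < d \<Longrightarrow> dist ((\<lambda>(t, z). H t z) q) ((\<lambda>(t, z). H t z) p) < e'"
      using uc by metis
    have "?h t \<in> mball (?h s) e" if t: "t \<in> {0..1} \<inter> ball s d" for t
    proof -
      have "cstar_norm (H s z - H t z) \<le> e / 2" if z: "z \<in> circle" for z
      proof -
        have "norm (H s z - H t z) < e'"
          using d(2)[of "(t, z)" "(s, z)"] s t z by (auto simp: dist_norm[symmetric] dist_Pair_Pair dist_commute)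
        have "cstar_norm (H s z - H t z) \<le> norm (H s z - H t z) * (\<bar>K\<bar> + 1)"
          by (rule order_trans[OF K]) (simp add: mult_left_mono)
        also have "\<dots> \<le> e' * (\<bar>K\<bar> + 1)"
          using \<open>norm (H s z - H t z) < e'\<close> by (intro mult_right_mono) auto
        also have "\<dots> = e / 2"
          by (simp add: e'_def field_simps add_pos_nonneg)
        finally show ?thesis .
      qed
      then have "M_dist (?h s) (?h t) \<le> e / 2"
        using H s t by (subst M_dist_le_iff) (auto simp: M_unitaries_def)
      then show ?thesis
        using e H s t by auto
    qed
    then show "\<exists>U. openin (top_of_set {0..1}) U \<and> s \<in> U \<and> (\<forall>t\<in>U. ?h t \<in> mball (?h s) e)"
      using s d(1) by (intro exI[of _ "{0..1} \<inter> ball s d"]) (auto simp: openin_open_Int)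
  qed
  then have "connectedin mtopology (?h ` {0..1})"
    by (rule connectedin_continuous_map_image) (simp add: connectedin_subtopology)
  then show ?thesis
    unfolding connected_component_of_def M_unitaries_top_def by fastforce
qed

lemma cmod_diff_unit:
  assumes "cmod a = 1" "cmod b = 1"
  shows "(cmod (a - b))\<^sup>2 = 2 - 2 * Re (cnj b * a)"
proof -
  have "(Re a)\<^sup>2 + (Im a)\<^sup>2 = 1" "(Re b)\<^sup>2 + (Im b)\<^sup>2 = 1"
    using assms by (metis cmod_power2 one_power2)+
  moreover have "(cmod (a - b))\<^sup>2 = (Re a - Re b)\<^sup>2 + (Im a - Im b)\<^sup>2"
    by (simp add: cmod_power2)
  ultimately show ?thesis
    by (simp add: power2_diff)
qed

text \<open>Translates distance bounds on eigenvalues into linear conditions: radius sqrt 2 means a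
  nonnegative real part, and squared radius 2 - sqrt 3 means a real part of at least sqrt 3 /
  2.\<close>

lemma cmod_diff_unit_le_iff:
  assumes "cmod a = 1" "cmod b = 1" "0 \<le> r"
  shows "cmod (a - b) \<le> r \<longleftrightarrow> 2 - r\<^sup>2 \<le> 2 * Re (cnj b * a)"
  using abs_le_square_iff[of "cmod (a - b)" r] cmod_diff_unit[OF assms(1,2)] assms(3) by auto

text \<open>The distance bound puts the eigenvalues a of u* v in the closed right half plane, so 1 +
  t a does not vanish for t in [0, 1]. Dividing it by its conjugate gives a path of unitary
  eigenvalues from 1 to a.\<close>

lemma unitaries_close_connected:
  assumes u: "u \<in> M_unitaries" and v: "v \<in> M_unitaries" and d: "M_dist u v \<le> sqrt 2"
  shows "connected_component_of M_unitaries_top u v"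
proof -
  define N where "N t z = mat 1 + mat_scale (of_real t) (mat_adjoint (u z) ** v z)" for t :: real and z
  define H where "H t z = u z ** cayley (N t z)" for t z
  have *: "det (N t z) \<noteq> 0 \<and> unitary_mat (H t z) \<and> transpose (H t z) = H t z \<and> H 0 z = u z \<and> H 1 z = v z"
    if t: "t \<in> {0..1}" and z: "z \<in> circle" for t z
  proof -
    obtain P Q a b where PQ: "unitary_mat P" "unitary_mat Q" and ab: "cmod a = 1" "cmod b = 1"
      and uz: "u z = P ** Q" and vz: "v z = P ** diag2 a b ** Q"
      using unitary_mat_pair[OF M_unitariesD(4)[OF u z] M_unitariesD(4)[OF v z]] by metis
    have "v z - u z = P ** diag2 (a - 1) (b - 1) ** Q"
      unfolding uz vz sandwich_one[of P Q] diag2_sandwich_linear ..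
    moreover have "cstar_norm (v z - u z) \<le> sqrt 2"
      using M_dist_upper[of u v z] d z u v cstar_norm_minus[of "u z - v z"] by (simp add: M_unitaries_def)
    ultimately have "cmod (a - 1) \<le> sqrt 2" "cmod (b - 1) \<le> sqrt 2"
      using cstar_norm_unitary_diag2[OF PQ, of "a - 1" "b - 1"] by auto
    then have Re: "0 \<le> Re a" "0 \<le> Re b"
      using ab cmod_diff_unit_le_iff[of a 1 "sqrt 2"] cmod_diff_unit_le_iff[of b 1 "sqrt 2"] by auto
    have nz: "1 + of_real s * c \<noteq> 0" if "0 \<le> Re c" "s \<in> {0..1}" for c and s :: real
    proof -
      have "Re (1 + of_real s * c) > 0"
        using that by (simp add: add_pos_nonneg)
      then show ?thesis
        by (metis less_irrefl zero_complex.simps(1))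
    qed
    have N: "N s z = mat_adjoint Q ** diag2 (1 + of_real s * a) (1 + of_real s * b) ** Q" for s
    proof -
      have "mat_adjoint (u z) ** v z = mat_adjoint Q ** diag2 a b ** Q"
        unfolding uz vz mat_adjoint_mult
        by (simp add: matrix_mul_assoc[symmetric] unitary_mat_cancel_left[OF PQ(1)])
      then show ?thesis
        unfolding N_def by (simp add: mat_conj_diag2[OF PQ(2), of 1] diag2_sandwich_linear)
    qed
    have HPQ: "H s z = P ** diag2 ((1 + of_real s * a) / cnj (1 + of_real s * a)) ((1 + of_real s * b) / cnj (1 + of_real s * b)) ** Q"
      if "s \<in> {0..1}" for s
      unfolding H_def N cayley_conj_diag2[OF PQ(2) nz[OF Re(1) that] nz[OF Re(2) that]] uz
      by (simp add: matrix_mul_assoc[symmetric] unitary_mat_cancel_left[OF PQ(2)])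
    \<comment> \<open>The endpoint of the path: c times 1 + cnj c is c + 1 on the unit
      circle.\<close>
    have cd1: "(1 + of_real 1 * c) / cnj (1 + of_real 1 * c) = c" if "cmod c = 1" "0 \<le> Re c" for c
    proof -
      have "c * cnj c = 1"
        using that by (metis complex_norm_square of_real_1 one_power2)
      moreover have "cnj (1 + of_real 1 * c) \<noteq> 0"
        using nz[OF that(2), of 1] by (simp only: complex_cnj_zero_iff) simp
      ultimately show ?thesis
        by (simp add: field_simps)
    qed
    have "H 0 z = u z" "H 1 z = v z"
      using HPQ[of 0] HPQ[of 1] cd1 ab Re by (simp_all add: uz vz diag2_one)
    moreover have "det (N t z) \<noteq> 0"
      unfolding N det_conj_diag2[OF PQ(2)] using nz[OF Re(1) t] nz[OF Re(2) t] by simp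
    moreover have "unitary_mat (H t z)"
      unfolding HPQ[OF t] using nz[OF Re(1) t] nz[OF Re(2) t]
      by (intro unitary_mat_mult PQ) (simp add: unitary_mat_diag2 norm_divide del: complex_cnj_add)
    moreover have "transpose (H t z) = H t z"
      unfolding HPQ[OF t]
      by (rule transpose_diag2_sandwich[of P Q a b, folded uz vz])
        (simp_all only: M_unitariesD(3)[OF u z] M_unitariesD(3)[OF v z])
    ultimately show ?thesis by simp
  qed
  have cuv: "continuous_on ({0..1} \<times> circle) (\<lambda>p. u (snd p))" "continuous_on ({0..1} \<times> circle) (\<lambda>p. v (snd p))"
    using M_unitariesD(2)[OF u] M_unitariesD(2)[OF v]
    by (auto intro!: continuous_on_compose2[of circle _ _ snd] continuous_intros)
  have contH: "continuous_on ({0..1} \<times> circle) (\<lambda>(t, z). H t z)"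
    unfolding H_def N_def case_prod_beta
    by (intro continuous_intros continuous_on_cayley cuv) (use * in \<open>auto simp: N_def\<close>)
  have "restrict (H t) circle \<in> M_unitaries" if t: "t \<in> {0..1}" for t
  proof (rule M_unitariesI)
    show "continuous_on circle (H t)"
      using continuous_on_compose2[OF contH, of circle "\<lambda>z. (t, z)"] t
      by (simp add: continuous_on_Pair image_subset_iff)
  qed (use * t in auto)
  note mem = this
  have "connected_component_of M_unitaries_top (restrict (H 0) circle) (restrict (H 1) circle)"
    by (rule homotopic_unitaries_connected[OF contH mem])
  moreover have "restrict (H 0) circle = u" "restrict (H 1) circle = v"
    by (rule M_unitaries_eqI; use u v mem *[of 0] in simp)+
  ultimately show ?thesis by simp
qed

lemma unit_mult_cnj: "cmod a = 1 \<Longrightarrow> a * cnj a = 1"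
  by (metis complex_norm_square of_real_1 one_power2)

lemma unit_Re_Im: "cmod a = 1 \<Longrightarrow> (Re a)\<^sup>2 + (Im a)\<^sup>2 = 1"
  by (metis cmod_power2 one_power2)

lemma unit_Re_eq_1: "cmod a = 1 \<Longrightarrow> 1 \<le> Re a \<Longrightarrow> a = 1"
proof -
  assume a: "cmod a = 1" "1 \<le> Re a"
  have "Re a = 1"
    using a complex_Re_le_cmod[of a] by simp
  moreover from this have "Im a = 0"
    using unit_Re_Im[OF a(1)] by simp
  ultimately show ?thesis
    by (simp add: complex_eq_iff)
qed

lemma M_unitaries_pair:
  assumes "u \<in> M_unitaries" "v \<in> M_unitaries" "z \<in> circle"
  obtains P Q a b where "unitary_mat P" "unitary_mat Q" "cmod a = 1" "cmod b = 1"
    "u z = P ** diag2 1 1 ** Q" "v z = P ** diag2 a b ** Q"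
proof -
  obtain P Q a b where *: "unitary_mat P" "unitary_mat Q" "cmod a = 1" "cmod b = 1"
    "u z = P ** Q" "v z = P ** diag2 a b ** Q"
    using unitary_mat_pair[OF M_unitariesD(4)[OF assms(1,3)] M_unitariesD(4)[OF assms(2,3)]] by metis
  show thesis
    by (rule that[of P Q a b]) (use * in \<open>simp_all add: diag2_one\<close>)
qed

lemma M_dist_commute: "M_dist u v = M_dist v u"
  by (rule Metric_space.commute[OF Metric_space_M_alg])

lemma cstar_norm_le_M_dist:
  assumes "u \<in> M_unitaries" "v \<in> M_unitaries" "z \<in> circle"
  shows "cstar_norm (u z - v z) \<le> M_dist u v"
  using assms M_dist_upper by (simp add: M_unitaries_def)

lemma sandwich_dist:
  "unitary_mat P \<Longrightarrow> unitary_mat Q \<Longrightarrow>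
    cstar_norm (P ** diag2 a b ** Q - P ** diag2 c d ** Q) = max (cmod (a - c)) (cmod (b - d))"
  unfolding diag2_sandwich_linear by (rule cstar_norm_unitary_diag2)

section \<open>Scalar rotations and their midpoints\<close>

definition fun_scale :: "complex \<Rightarrow> cmat_fun \<Rightarrow> cmat_fun" where
  "fun_scale c u = (\<lambda>z\<in>circle. mat_scale c (u z))"

lemma fun_scale_in_M_unitaries:
  assumes "u \<in> M_unitaries" "cmod c = 1"
  shows "fun_scale c u \<in> M_unitaries"
  unfolding fun_scale_def
proof (rule M_unitariesI)
  show "continuous_on circle (\<lambda>z. mat_scale c (u z))"
    by (intro continuous_intros M_unitariesD(2) assms)
next
  fix z assume z: "z \<in> circle"
  have "transpose (mat_scale c (u z)) = mat_scale c (transpose (u z))"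
    by (simp add: vec_eq_iff transpose_def)
  then show "transpose (mat_scale c (u z)) = mat_scale c (u z)"
    using M_unitariesD(3)[OF assms(1) z] by simp
  have "mat_scale c (u z) = diag2 c c ** u z"
    by (simp add: mat2_simps)
  then show "unitary_mat (mat_scale c (u z))"
    using assms M_unitariesD(4)[OF assms(1) z] by (simp add: unitary_mat_mult unitary_mat_diag2)
qed

lemma M_dist_fun_scale:
  assumes "u \<in> M_unitaries" "cmod c = 1" "cmod d = 1"
  shows "M_dist (fun_scale c u) (fun_scale d u) \<le> cmod (c - d)"
proof (subst M_dist_le_iff)
  show "fun_scale c u \<in> M_alg" "fun_scale d u \<in> M_alg"
    using assms fun_scale_in_M_unitaries by (auto simp: M_unitaries_def)
  show "\<forall>z\<in>circle. cstar_norm (fun_scale c u z - fun_scale d u z) \<le> cmod (c - d)"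
  proof
    fix z assume z: "z \<in> circle"
    obtain P Q a b where "unitary_mat P" "unitary_mat Q" "u z = P ** diag2 1 1 ** Q"
      using M_unitaries_pair[OF assms(1,1) z] by metis
    then show "cstar_norm (fun_scale c u z - fun_scale d u z) \<le> cmod (c - d)"
      using z by (simp add: fun_scale_def diag2_sandwich_linear(3) sandwich_dist)
  qed
qed

text \<open>For an eigenvalue s of u* p, both Re s and the real part of s / c^2 are at least Re c,
  while their sum is 2 Re c times the real part of s / c. Hence s / c is a unit number with real
  part at least 1.\<close>

lemma unique_midpoint:
  assumes u: "u \<in> M_unitaries" and p: "p \<in> M_unitaries" and c: "cmod c = 1" "0 < Re c"
    and d: "M_dist p u \<le> cmod (c - 1)" "M_dist p (fun_scale (c\<^sup>2) u) \<le> cmod (c - 1)"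
  shows "p = fun_scale c u"
proof (rule M_unitaries_eqI[OF p fun_scale_in_M_unitaries[OF u c(1)]])
  fix z assume z: "z \<in> circle"
  obtain P Q a b where PQ: "unitary_mat P" "unitary_mat Q" and ab: "cmod a = 1" "cmod b = 1"
    and uz: "u z = P ** diag2 1 1 ** Q" and pz: "p z = P ** diag2 a b ** Q"
    using M_unitaries_pair[OF u p z] by metis
  have c2: "cmod (c\<^sup>2) = 1"
    using c by (simp add: norm_power)
  have "cstar_norm (p z - u z) \<le> cmod (c - 1)"
    using cstar_norm_le_M_dist[OF p u z] d(1) by simp
  moreover have "cstar_norm (p z - mat_scale (c\<^sup>2) (u z)) \<le> cmod (c - 1)"
    using cstar_norm_le_M_dist[OF p fun_scale_in_M_unitaries[OF u c2] z] d(2) z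
    by (simp add: fun_scale_def)
  ultimately have le: "cmod (a - 1) \<le> cmod (c - 1)" "cmod (a - c\<^sup>2) \<le> cmod (c - 1)"
    "cmod (b - 1) \<le> cmod (c - 1)" "cmod (b - c\<^sup>2) \<le> cmod (c - 1)"
    unfolding uz pz diag2_sandwich_linear(3) sandwich_dist[OF PQ] by simp_all
  have "s = c" if s: "cmod s = 1" "cmod (s - 1) \<le> cmod (c - 1)" "cmod (s - c\<^sup>2) \<le> cmod (c - 1)" for s
  proof -
    define e where "e = cnj c * s"
    have ce: "s = c * e" "cnj (c\<^sup>2) * s = cnj c * e"
      using unit_mult_cnj[OF c(1)] by (simp_all add: e_def power2_eq_square flip: mult.assoc)
    have "2 * Re c \<le> 2 * Re s"
      using s(1,2) c cmod_diff_unit_le_iff[of s 1 "cmod (c - 1)"] cmod_diff_unit[of c 1] by simp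
    moreover have "2 * Re c \<le> 2 * Re (cnj (c\<^sup>2) * s)"
      using cmod_diff_unit_le_iff[OF s(1) c2, of "cmod (c - 1)"] s(3) c cmod_diff_unit[of c 1] by simp
    moreover have "Re s + Re (cnj (c\<^sup>2) * s) = 2 * (Re c * Re e)"
      unfolding ce(2) by (subst ce(1)) simp
    ultimately have "Re c * 1 \<le> Re c * Re e"
      by simp
    then have "1 \<le> Re e"
      using c(2) mult_le_cancel_left_pos by blast
    moreover have "cmod e = 1"
      using c s by (simp add: e_def norm_mult)
    ultimately show "s = c"
      using ce(1) unit_Re_eq_1 by simp
  qed
  then have "a = c" "b = c"
    using le ab by auto
  then show "p z = fun_scale c u z"
    using z by (simp add: fun_scale_def uz pz diag2_sandwich_linear(3))
qed

section \<open>Square roots and rotations of unit numbers near 1\<close>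

lemma csqrt_near_1:
  assumes "cmod a = 1" "cmod (a - 1) \<le> 1"
  shows "cmod (csqrt a) = 1" "sqrt 3 / 2 \<le> Re (csqrt a)" "\<bar>Im (csqrt a)\<bar> \<le> 1/2"
proof -
  define s where "s = csqrt a"
  have n: "cmod s = 1" and s0: "0 \<le> Re s"
    using assms by (simp_all add: s_def Re_csqrt del: csqrt.sel)
  \<comment> \<open>The angle of \<open>a\<close> is at most pi/3, so that of its root is at most
    pi/6; this is expressed by real and imaginary parts.\<close>
  have "1 \<le> 2 * Re a"
    using assms cmod_diff_unit_le_iff[of a 1 1] by simp
  moreover have "Re a = (Re s)\<^sup>2 - (Im s)\<^sup>2"
    unfolding s_def by (metis Re_power2 power2_csqrt)
  ultimately have sq: "3/4 \<le> (Re s)\<^sup>2" "(Im s)\<^sup>2 \<le> 1/4"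
    using unit_Re_Im[OF n] by linarith+
  have "(sqrt 3 / 2)\<^sup>2 \<le> (Re s)\<^sup>2"
    using sq(1) by (simp add: power_divide)
  then have "sqrt 3 / 2 \<le> Re s"
    using s0 by (rule power2_le_imp_le)
  moreover have "\<bar>Im s\<bar> \<le> 1/2"
    using sq(2) abs_le_square_iff[of "Im s" "1/2"] by (simp add: power_divide)
  ultimately show "cmod (csqrt a) = 1" "sqrt 3 / 2 \<le> Re (csqrt a)" "\<bar>Im (csqrt a)\<bar> \<le> 1/2"
    using n by (simp_all only: s_def)
qed

text \<open>Both roots have angle at most pi/6, so their product and their sum stay in the open
  right half plane, where a number is the principal root of its square. The sum is the trace of the
  square root matrix.\<close>

lemma csqrt_mult_near_1:
  assumes "cmod a = 1" "cmod (a - 1) \<le> 1" "cmod b = 1" "cmod (b - 1) \<le> 1"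
  shows "csqrt (a * b) = csqrt a * csqrt b" "0 < Re (csqrt (a * b))"
    "csqrt (a + b + 2 * csqrt (a * b)) = csqrt a + csqrt b" "0 < Re (csqrt a + csqrt b)"
proof -
  define s t where "s = csqrt a" and "t = csqrt b"
  note st = csqrt_near_1[OF assms(1,2), folded s_def] csqrt_near_1[OF assms(3,4), folded t_def]
  have pos: "0 < sqrt 3 / 2"
    by simp
  have "0 \<le> Re s" "0 \<le> Re t"
    using st pos by linarith+
  then have "(sqrt 3 / 2) * (sqrt 3 / 2) \<le> Re s * Re t"
    using st pos by (intro mult_mono) linarith+
  moreover have "(sqrt 3 / 2) * (sqrt 3 / 2) = 3/4"
    by simp
  moreover have "\<bar>Im s\<bar> * \<bar>Im t\<bar> \<le> (1/2) * (1/2)"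
    using st by (intro mult_mono) linarith+
  ultimately have Re: "0 < Re (s * t)"
    unfolding times_complex.simps abs_mult[symmetric] by linarith
  have *: "csqrt (a * b) = s * t"
  proof (rule csqrt_unique)
    show "(s * t)\<^sup>2 = a * b"
      by (simp add: power_mult_distrib s_def t_def)
  qed (use Re in blast)
  then show "csqrt (a * b) = csqrt a * csqrt b"
    by (simp only: s_def t_def)
  show "0 < Re (csqrt (a * b))"
    unfolding * by (rule Re)
  have Re': "0 < Re (s + t)"
    using st pos unfolding plus_complex.simps by linarith
  then show "0 < Re (csqrt a + csqrt b)"
    by (simp only: s_def t_def)
  show "csqrt (a + b + 2 * csqrt (a * b)) = csqrt a + csqrt b"
    unfolding * s_def[symmetric] t_def[symmetric]
  proof (rule csqrt_unique)
    show "(s + t)\<^sup>2 = a + b + 2 * (s * t)"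
      by (simp add: power2_sum s_def t_def)
  qed (use Re' in blast)
qed

lemma csqrt_pos_not_nonpos: "0 < Re (csqrt w) \<Longrightarrow> w \<notin> \<real>\<^sub>\<le>\<^sub>0"
  using csqrt_of_real_nonpos[of w] by (auto simp: complex_nonpos_Reals_iff simp del: csqrt.sel)

text \<open>A rotation by the angle \<open>2 arctan ((2 Re s - sqrt 3) / 4)\<close>, small enough that \<open>s * twist s\<close> and
  \<open>cnj s * twist s\<close> keep real part at least \<open>sqrt 3 / 2\<close>, and trivial only at \<open>s = exp(\<plusminus>i pi/6)\<close>.\<close>

definition twist :: "complex \<Rightarrow> complex" where
  "twist s = (1 + \<i> * of_real ((2 * Re s - sqrt 3) / 4)) / cnj (1 + \<i> * of_real ((2 * Re s - sqrt 3) / 4))"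

text \<open>Up to the factor 1 + k^2, the excess over sqrt 3 / 2 is k (2 - k (Re s + sqrt 3 / 2) - 2
  y), where y is Im s or its negative. Since k is at most 1/4 and |y| at most 1/2, the bracket is
  positive. A trivial twist means k = 0.\<close>

lemma twist_bounds:
  assumes s: "cmod s = 1" "sqrt 3 / 2 \<le> Re s" "\<bar>Im s\<bar> \<le> 1/2"
  shows "cmod (twist s) = 1" "sqrt 3 / 2 \<le> Re (s * twist s)" "sqrt 3 / 2 \<le> Re (cnj s * twist s)"
    "twist s = 1 \<Longrightarrow> 2 * Re s = sqrt 3"
proof -
  define k where "k = (2 * Re s - sqrt 3) / 4"
  define N where "N = 1 + \<i> * of_real k"
  have t: "twist s = N / cnj N"
    by (simp add: twist_def N_def k_def)
  have N0: "N \<noteq> 0"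
    by (simp add: N_def complex_eq_iff)
  show "cmod (twist s) = 1"
    using N0 by (simp add: t norm_divide)
  have k: "0 \<le> k" "k \<le> 1/4" and Re: "Re s = sqrt 3 / 2 + 2 * k"
  proof -
    have "Re s \<le> 1"
      using complex_Re_le_cmod[of s] s(1) by simp
    moreover have "1 \<le> sqrt 3"
      by simp
    ultimately have "2 * Re s \<le> 1 + sqrt 3"
      by linarith
    then show "0 \<le> k" "k \<le> 1/4"
      using s(2) by (simp_all add: k_def)
    show "Re s = sqrt 3 / 2 + 2 * k"
      unfolding k_def by (simp add: field_simps)
  qed
  have le2: "Re s + sqrt 3 / 2 \<le> 2"
    using complex_Re_le_cmod[of s] s(1,2) by simp
  have pos: "0 < 1 + k\<^sup>2"
    by (simp add: add_pos_nonneg)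
  have t': "twist s = N\<^sup>2 / of_real (1 + k\<^sup>2)"
  proof -
    have "N * cnj N = of_real (1 + k\<^sup>2)"
      by (simp add: N_def complex_eq_iff power2_eq_square)
    then show ?thesis
      using N0 unfolding t by (metis complex_cnj_zero_iff mult_divide_mult_cancel_left power2_eq_square)
  qed
  have ReN: "Re (x * twist s) = (Re x * (1 - k\<^sup>2) - 2 * k * Im x) / (1 + k\<^sup>2)" for x
    unfolding t' by (simp add: N_def power2_eq_square Re_divide_of_real del: of_real_add)
  have main: "sqrt 3 / 2 \<le> (Re s * (1 - k\<^sup>2) - 2 * k * y) / (1 + k\<^sup>2)" if "\<bar>y\<bar> \<le> 1/2" for y
  proof -
    have "0 < sqrt 3 / 2"
      by simp
    then have "0 \<le> Re s + sqrt 3 / 2"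
      using s(2) by linarith
    then have "k * (Re s + sqrt 3 / 2) \<le> 1/4 * 2"
      using k le2 by (intro mult_mono) auto
    then have "0 \<le> 2 - k * (Re s + sqrt 3 / 2) - 2 * y"
      using that by linarith
    then have "0 \<le> k * (2 - k * (Re s + sqrt 3 / 2) - 2 * y)"
      using k(1) by (rule mult_nonneg_nonneg[rotated])
    also have "\<dots> = Re s * (1 - k\<^sup>2) - 2 * k * y - sqrt 3 / 2 * (1 + k\<^sup>2)"
      using Re by (simp add: power2_eq_square algebra_simps)
    finally show ?thesis
      using pos by (simp add: pos_le_divide_eq)
  qed
  show "sqrt 3 / 2 \<le> Re (s * twist s)" "sqrt 3 / 2 \<le> Re (cnj s * twist s)"
    unfolding ReN using main[of "Im s"] main[of "- Im s"] s(3) by simp_all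
  assume "twist s = 1"
  then have "N = cnj N"
    using N0 by (simp add: t)
  then show "2 * Re s = sqrt 3"
    by (simp add: N_def k_def complex_eq_iff)
qed

text \<open>A root with positive real part certifies that its argument avoids the branch
  cut.\<close>

lemma csqrt_continuous_on:
  assumes "continuous_on S f" "\<And>x. x \<in> S \<Longrightarrow> 0 < Re (csqrt (f x))"
  shows "continuous_on S (\<lambda>x. csqrt (f x))"
  by (rule continuous_on_compose2[OF continuous_on_csqrt assms(1)])
    (use csqrt_pos_not_nonpos assms(2) in auto)

section \<open>Isolated midpoints\<close>

text \<open>By Cayley-Hamilton, a square root \<open>Z\<close> of \<open>W\<close> with \<open>det Z = d\<close> satisfies \<open>W + d = (trace Z) Z\<close> and
  \<open>(trace Z)\<^sup>2 = trace W + 2 d\<close>.\<close>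

definition relative_sqrt :: "complex^2^2 \<Rightarrow> complex^2^2 \<Rightarrow> complex^2^2" where
  "relative_sqrt U V = (let W = mat_adjoint U ** V; d = csqrt (det W)
     in mat_scale (1 / csqrt (trace W + 2 * d)) (W + mat d))"

text \<open>For an eigenvalue s of the square root, the eigenvalue here is the numerator of
  \<open>twist s\<close>, so \<open>cayley\<close> of this matrix applies \<open>twist\<close> to
  the square root.\<close>

definition relative_twist :: "complex^2^2 \<Rightarrow> complex^2^2 \<Rightarrow> complex^2^2" where
  "relative_twist U V = (let Z = relative_sqrt U V
     in mat 1 + mat_scale (\<i> / 4) (Z + mat_adjoint Z - mat (of_real (sqrt 3))))"

lemma M_unitaries_near_pair:
  assumes "u \<in> M_unitaries" "v \<in> M_unitaries" "M_dist u v \<le> 1" "z \<in> circle"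
  obtains P Q a b where "unitary_mat P" "unitary_mat Q" "cmod a = 1" "cmod b = 1"
    "cmod (a - 1) \<le> 1" "cmod (b - 1) \<le> 1"
    "u z = P ** diag2 1 1 ** Q" "v z = P ** diag2 a b ** Q"
    "mat_adjoint (u z) ** v z = mat_adjoint Q ** diag2 a b ** Q"
proof -
  obtain P Q a b where PQ: "unitary_mat P" "unitary_mat Q" and ab: "cmod a = 1" "cmod b = 1"
    and uv: "u z = P ** diag2 1 1 ** Q" "v z = P ** diag2 a b ** Q"
    using M_unitaries_pair[OF assms(1,2,4)] by metis
  have "cstar_norm (v z - u z) \<le> 1"
    using cstar_norm_le_M_dist[OF assms(2,1,4)] assms(3) M_dist_commute[of u v] by simp
  then have "cmod (a - 1) \<le> 1" "cmod (b - 1) \<le> 1"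
    unfolding uv sandwich_dist[OF PQ] by simp_all
  moreover have "mat_adjoint (u z) ** v z = mat_adjoint Q ** diag2 a b ** Q"
    unfolding uv diag2_one matrix_mul_rid mat_adjoint_mult
    by (simp add: matrix_mul_assoc[symmetric] unitary_mat_cancel_left[OF PQ(1)])
  ultimately show thesis
    using that PQ ab uv by metis
qed

lemma relative_sqrt_sandwich:
  assumes Q: "unitary_mat Q"
    and ab: "cmod a = 1" "cmod (a - 1) \<le> 1" "cmod b = 1" "cmod (b - 1) \<le> 1"
    and W: "mat_adjoint U ** V = mat_adjoint Q ** diag2 a b ** Q"
  shows "relative_sqrt U V = mat_adjoint Q ** diag2 (csqrt a) (csqrt b) ** Q"
proof -
  define s t where "s = csqrt a" and "t = csqrt b"
  note st = csqrt_mult_near_1[OF ab, folded s_def t_def]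
  have sq: "a = s * s" "b = t * t"
    by (simp_all add: s_def t_def flip: power2_eq_square)
  have nz: "s + t \<noteq> 0"
    using st(4) by (metis less_irrefl zero_complex.simps(1))
  have "relative_sqrt U V = mat_adjoint Q ** diag2 (1 / (s + t) * (a + s * t)) (1 / (s + t) * (b + s * t)) ** Q"
    unfolding relative_sqrt_def Let_def W trace_conj_diag2[OF Q] det_conj_diag2[OF Q] st(3)
    unfolding st(1) mat_conj_diag2[OF Q, of "s * t"] diag2_sandwich_linear ..
  \<comment> \<open>Here a + s t = s (s + t) and b + s t = t (s + t).\<close>
  moreover have "1 / (s + t) * (a + s * t) = s" "1 / (s + t) * (b + s * t) = t"
    using nz by (simp_all add: sq field_simps)
  ultimately show ?thesis
    by (simp only: s_def t_def)
qed

lemma relative_twist_sandwich: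
  assumes Q: "unitary_mat Q"
    and ab: "cmod a = 1" "cmod (a - 1) \<le> 1" "cmod b = 1" "cmod (b - 1) \<le> 1"
    and W: "mat_adjoint U ** V = mat_adjoint Q ** diag2 a b ** Q"
  shows "det (relative_twist U V) \<noteq> 0"
    "cayley (relative_twist U V) = mat_adjoint Q ** diag2 (twist (csqrt a)) (twist (csqrt b)) ** Q"
proof -
  define N where "N s = 1 + \<i> * of_real ((2 * Re s - sqrt 3) / 4)" for s
  have N: "N s = 1 + \<i> / 4 * (s + cnj s - of_real (sqrt 3))" for s
    by (simp add: N_def complex_eq_iff)
  have nz: "N s \<noteq> 0" for s
    by (simp add: N_def complex_eq_iff)
  have *: "relative_twist U V = mat_adjoint Q ** diag2 (N (csqrt a)) (N (csqrt b)) ** Q"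
    unfolding relative_twist_def Let_def relative_sqrt_sandwich[OF assms] mat_adjoint_conj_diag2
      mat_conj_diag2[OF Q, of 1] mat_conj_diag2[OF Q, of "of_real (sqrt 3)"] diag2_sandwich_linear N ..
  show "det (relative_twist U V) \<noteq> 0"
    unfolding * det_conj_diag2[OF Q] using nz by simp
  show "cayley (relative_twist U V) = mat_adjoint Q ** diag2 (twist (csqrt a)) (twist (csqrt b)) ** Q"
    unfolding * cayley_conj_diag2[OF Q nz nz] by (simp only: twist_def N_def)
qed

text \<open>Distance at most 1 keeps both complex roots in the open right half plane, so the
  principal branch is continuous around the whole circle.\<close>

lemma continuous_relative_sqrt:
  assumes u: "u \<in> M_unitaries" and v: "v \<in> M_unitaries" and d: "M_dist u v \<le> 1"
  shows "continuous_on circle (\<lambda>z. csqrt (det (mat_adjoint (u z) ** v z)))"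
    "continuous_on circle (\<lambda>z. relative_sqrt (u z) (v z))"
proof -
  let ?W = "\<lambda>z. mat_adjoint (u z) ** v z"
  have W: "continuous_on circle ?W"
    by (intro continuous_intros M_unitariesD(2) u v)
  have pos: "0 < Re (csqrt (det (?W z)))" "0 < Re (csqrt (trace (?W z) + 2 * csqrt (det (?W z))))"
    if z: "z \<in> circle" for z
  proof -
    obtain P Q a b where PQ: "unitary_mat P" "unitary_mat Q" and ab: "cmod a = 1" "cmod b = 1"
      "cmod (a - 1) \<le> 1" "cmod (b - 1) \<le> 1" and Wz: "?W z = mat_adjoint Q ** diag2 a b ** Q"
      using M_unitaries_near_pair[OF u v d z] by metis
    note * = csqrt_mult_near_1[OF ab(1,3,2,4)]
    show "0 < Re (csqrt (det (?W z)))" "0 < Re (csqrt (trace (?W z) + 2 * csqrt (det (?W z))))"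
      unfolding Wz det_conj_diag2[OF PQ(2)] trace_conj_diag2[OF PQ(2)] *(3) by (rule *(2), rule *(4))
  qed
  show d: "continuous_on circle (\<lambda>z. csqrt (det (?W z)))"
    by (intro csqrt_continuous_on continuous_on_det2 W pos)
  have t: "continuous_on circle (\<lambda>z. csqrt (trace (?W z) + 2 * csqrt (det (?W z))))"
    by (intro csqrt_continuous_on continuous_intros W d pos)
  have "csqrt (trace (?W z) + 2 * csqrt (det (?W z))) \<noteq> 0" if "z \<in> circle" for z
    using pos(2)[OF that] by (metis less_irrefl zero_complex.simps(1))
  then show "continuous_on circle (\<lambda>z. relative_sqrt (u z) (v z))"
    unfolding relative_sqrt_def Let_def by (intro continuous_intros W d t) auto
qed

lemma isolated_midpoint_imp_linear:
  assumes y0: "y0 \<in> M_unitaries" and y1: "y1 \<in> M_unitaries" and y2: "y2 \<in> M_unitaries"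
    and d: "M_dist y0 y2 \<le> 1"
    and uniq: "\<And>p. p \<in> M_unitaries \<Longrightarrow> (M_dist p y0)\<^sup>2 \<le> 2 - sqrt 3 \<Longrightarrow> (M_dist p y2)\<^sup>2 \<le> 2 - sqrt 3 \<Longrightarrow> p = y1"
    and z: "z \<in> circle"
  shows "y0 z + y2 z = mat_scale (of_real (sqrt 3)) (y1 z)"
proof -
  define m where "m = (\<lambda>z. y0 z ** relative_sqrt (y0 z) (y2 z))"
  define x where "x = (\<lambda>z. m z ** cayley (relative_twist (y0 z) (y2 z)))"
  note sqrt_cont = continuous_relative_sqrt(2)[OF y0 y2 d]
  have m_cont: "continuous_on circle m"
    unfolding m_def by (intro continuous_intros sqrt_cont M_unitariesD(2) y0)
  have nz: "det (relative_twist (y0 z) (y2 z)) \<noteq> 0" if "z \<in> circle" for z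
    using M_unitaries_near_pair[OF y0 y2 d that] relative_twist_sandwich(1) by metis
  have "continuous_on circle (\<lambda>z. relative_twist (y0 z) (y2 z))"
    unfolding relative_twist_def Let_def by (intro continuous_intros sqrt_cont)
  then have x_cont: "continuous_on circle x"
    unfolding x_def by (intro continuous_intros m_cont continuous_on_cayley nz)
  \<comment> \<open>Any continuous field obtained by applying a scalar function \<open>F\<close> to
    the eigenvalues of y0* y2 is an admissible competitor once \<open>F\<close> meets the two real
    part bounds, which encode the distances to \<open>y0\<close> and \<open>y2\<close>.\<close>
  have eq: "restrict f circle = y1"
    if cont: "continuous_on circle f"
      and f: "\<And>P Q a b z. z \<in> circle \<Longrightarrow> unitary_mat P \<Longrightarrow> unitary_mat Q \<Longrightarrow>
        cmod a = 1 \<Longrightarrow> cmod b = 1 \<Longrightarrow> cmod (a - 1) \<le> 1 \<Longrightarrow> cmod (b - 1) \<le> 1 \<Longrightarrow>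
        y0 z = P ** diag2 1 1 ** Q \<Longrightarrow> y2 z = P ** diag2 a b ** Q \<Longrightarrow>
        mat_adjoint (y0 z) ** y2 z = mat_adjoint Q ** diag2 a b ** Q \<Longrightarrow>
        f z = P ** diag2 (F a) (F b) ** Q"
      and F: "\<And>a. cmod a = 1 \<Longrightarrow> cmod (a - 1) \<le> 1 \<Longrightarrow>
        cmod (F a) = 1 \<and> sqrt 3 / 2 \<le> Re (F a) \<and> sqrt 3 / 2 \<le> Re (cnj a * F a)"
    for f F
  proof (rule uniq)
    \<comment> \<open>This is the chord |exp(i pi/6) - 1|.\<close>
    define r where "r = sqrt (2 - sqrt 3)"
    have r: "0 \<le> r" "r\<^sup>2 = 2 - sqrt 3"
      by (simp_all add: r_def real_le_lsqrt)
    have *: "transpose (f z) = f z" "unitary_mat (f z)"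
      "cstar_norm (f z - y0 z) \<le> r" "cstar_norm (f z - y2 z) \<le> r" if z: "z \<in> circle" for z
    proof -
      obtain P Q a b where PQ: "unitary_mat P" "unitary_mat Q" and ab: "cmod a = 1" "cmod b = 1"
        "cmod (a - 1) \<le> 1" "cmod (b - 1) \<le> 1"
        and y: "y0 z = P ** diag2 1 1 ** Q" "y2 z = P ** diag2 a b ** Q"
        and W: "mat_adjoint (y0 z) ** y2 z = mat_adjoint Q ** diag2 a b ** Q"
        using M_unitaries_near_pair[OF y0 y2 d z] by metis
      note fz = f[OF z PQ ab y W]
      have y0z: "P ** Q = y0 z"
        using y(1) by (simp add: diag2_one)
      show "transpose (f z) = f z"
        unfolding fz
        by (rule transpose_diag2_sandwich[of P Q a b, folded y(2), unfolded y0z])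
          (use M_unitariesD(3)[OF y0 z] M_unitariesD(3)[OF y2 z] in simp_all)
      show "unitary_mat (f z)"
        unfolding fz using F ab by (intro unitary_mat_mult PQ) (simp add: unitary_mat_diag2)
      have near: "cmod (F c - 1) \<le> r \<and> cmod (F c - c) \<le> r" if "cmod c = 1" "cmod (c - 1) \<le> 1" for c
        using F[OF that] cmod_diff_unit_le_iff[of "F c" 1 r] cmod_diff_unit_le_iff[of "F c" c r] that r by auto
      show "cstar_norm (f z - y0 z) \<le> r" "cstar_norm (f z - y2 z) \<le> r"
        unfolding fz y sandwich_dist[OF PQ] using near ab by simp_all
    qed
    show M: "restrict f circle \<in> M_unitaries"
      by (intro M_unitariesI cont *)
    have "M_dist (restrict f circle) y0 \<le> r" "M_dist (restrict f circle) y2 \<le> r"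
      using * M_unitariesD(1) M y0 y2 by (simp_all add: M_dist_le_iff)
    then show "(M_dist (restrict f circle) y0)\<^sup>2 \<le> 2 - sqrt 3" "(M_dist (restrict f circle) y2)\<^sup>2 \<le> 2 - sqrt 3"
      unfolding r(2)[symmetric] by (simp_all add: power_mono M_dist_nonneg)
  qed
  have m: "m z = P ** diag2 (csqrt a) (csqrt b) ** Q"
    if "unitary_mat P" "unitary_mat Q" "cmod a = 1" "cmod b = 1" "cmod (a - 1) \<le> 1" "cmod (b - 1) \<le> 1"
      "y0 z = P ** diag2 1 1 ** Q" "mat_adjoint (y0 z) ** y2 z = mat_adjoint Q ** diag2 a b ** Q"
    for P Q a b z
    unfolding m_def relative_sqrt_sandwich[OF that(2,3,5,4,6,8)] unfolding that(7)
    by (simp add: diag2_sandwich_mult[OF that(2)])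
  have x: "x z = P ** diag2 (csqrt a * twist (csqrt a)) (csqrt b * twist (csqrt b)) ** Q"
    if "unitary_mat P" "unitary_mat Q" "cmod a = 1" "cmod b = 1" "cmod (a - 1) \<le> 1" "cmod (b - 1) \<le> 1"
      "y0 z = P ** diag2 1 1 ** Q" "mat_adjoint (y0 z) ** y2 z = mat_adjoint Q ** diag2 a b ** Q"
    for P Q a b z
    unfolding x_def relative_twist_sandwich(2)[OF that(2,3,5,4,6,8)] m[OF that]
    by (rule diag2_sandwich_mult[OF that(2)])
  \<comment> \<open>Rewrites the bound for the distance to \<open>y2\<close> as one on the conjugate
    root.\<close>
  have cs: "cnj a * csqrt a = cnj (csqrt a)" if "cmod a = 1" for a
  proof -
    have "cnj a * csqrt a = cnj (csqrt a) * (csqrt a * cnj (csqrt a))"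
      by (metis complex_cnj_mult mult.assoc mult.commute power2_csqrt power2_eq_square)
    then show ?thesis
      using unit_mult_cnj[of "csqrt a"] that by simp
  qed
  have "restrict m circle = y1"
  proof (rule eq[of m csqrt, OF m_cont])
    show "cmod (csqrt a) = 1 \<and> sqrt 3 / 2 \<le> Re (csqrt a) \<and> sqrt 3 / 2 \<le> Re (cnj a * csqrt a)"
      if "cmod a = 1" "cmod (a - 1) \<le> 1" for a
      unfolding cs[OF that(1)] using csqrt_near_1[OF that] by (simp del: csqrt.sel)
  qed (rule m)
  moreover have "restrict x circle = y1"
  proof (rule eq[of x "\<lambda>a. csqrt a * twist (csqrt a)", OF x_cont])
    fix a assume a: "cmod a = 1" "cmod (a - 1) \<le> 1"
    note s = csqrt_near_1[OF a]
    have "cnj a * (csqrt a * twist (csqrt a)) = cnj (csqrt a) * twist (csqrt a)"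
      using cs[OF a(1)] by (simp add: mult.assoc[symmetric])
    then show "cmod (csqrt a * twist (csqrt a)) = 1 \<and> sqrt 3 / 2 \<le> Re (csqrt a * twist (csqrt a)) \<and>
        sqrt 3 / 2 \<le> Re (cnj a * (csqrt a * twist (csqrt a)))"
      using twist_bounds(1-3)[OF s] s(1) by (simp only: norm_mult) simp
  qed (rule x)
  ultimately have "restrict m circle z = y1 z" "restrict x circle z = y1 z"
    by simp_all
  then have mz: "y1 z = m z" and xz: "x z = m z"
    using z by simp_all
  obtain P Q a b where PQ: "unitary_mat P" "unitary_mat Q" and ab: "cmod a = 1" "cmod b = 1"
    "cmod (a - 1) \<le> 1" "cmod (b - 1) \<le> 1"
    and y: "y0 z = P ** diag2 1 1 ** Q" "y2 z = P ** diag2 a b ** Q"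
    and W: "mat_adjoint (y0 z) ** y2 z = mat_adjoint Q ** diag2 a b ** Q"
    using M_unitaries_near_pair[OF y0 y2 d z] by metis
  have "cstar_norm (x z - m z) = 0"
    by (simp add: xz cstar_norm_eq_0)
  then have tw: "csqrt a * twist (csqrt a) = csqrt a" "csqrt b * twist (csqrt b) = csqrt b"
    unfolding x[OF PQ ab y(1) W] m[OF PQ ab y(1) W] sandwich_dist[OF PQ] by (smt (verit) norm_le_zero_iff right_minus_eq)+
  \<comment> \<open>Both competitors equal \<open>y1\<close>, so the twist is trivial and s + cnj s
    = sqrt 3 for s = \<open>csqrt c\<close>; multiplying by s gives the claim.\<close>
  have "1 + c = of_real (sqrt 3) * csqrt c"
    if c: "cmod c = 1" "cmod (c - 1) \<le> 1" "csqrt c * twist (csqrt c) = csqrt c" for c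
  proof -
    define s where "s = csqrt c"
    note s = csqrt_near_1[OF c(1,2), folded s_def]
    have "s \<noteq> 0"
      using s(1) by auto
    then have "2 * Re s = sqrt 3"
      using c(3) twist_bounds(4)[OF s] by (simp add: s_def)
    then have "of_real (sqrt 3) = s + cnj s"
      by (simp add: complex_eq_iff)
    then have "of_real (sqrt 3) * s = s * s + s * cnj s"
      by (simp add: algebra_simps)
    then show ?thesis
      using unit_mult_cnj[OF s(1)] by (simp add: s_def flip: power2_eq_square)
  qed
  then show ?thesis
    unfolding mz m[OF PQ ab y(1) W] y diag2_sandwich_linear using ab tw by simp
qed

section \<open>Parity of the determinant\<close>

text \<open>Along the angle t such a root differs from exp(i t/2) by a sign. The sign is constant by
  continuity, yet exp(i t/2) changes sign after one turn.\<close>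

lemma no_continuous_sqrt_on_circle:
  assumes cont: "continuous_on circle r" and r: "\<And>z. z \<in> circle \<Longrightarrow> (r z)\<^sup>2 = (z :: complex)"
  shows False
proof -
  define h where "h t = r (cis t) * cis (- t / 2)" for t :: real
  have "(h t)\<^sup>2 = 1" for t
    using r[of "cis t"] by (simp add: h_def power_mult_distrib Complex.DeMoivre cis_mult)
  then have "h ` {0..2 * pi} \<subseteq> {1, -1}"
    by (auto simp: power2_eq_1_iff)
  then have fin: "finite (h ` {0..2 * pi})"
    by (rule finite_subset) simp
  have "continuous_on {0..2 * pi} h"
    unfolding h_def by (intro continuous_intros continuous_on_compose2[OF cont]) auto
  then have "h constant_on {0..2 * pi}"
    using fin by (intro continuous_finite_range_constant) auto
  then have "h 0 = h (2 * pi)"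
    unfolding constant_on_def by force
  then have "r 1 = 0"
    by (simp add: h_def) (simp add: complex_eq_iff)
  then show False
    using r[of 1] by simp
qed

text \<open>The winding number of \<open>det u\<close> is odd.\<close>

definition odd_det :: "cmat_fun \<Rightarrow> bool" where
  "odd_det u \<longleftrightarrow> (\<exists>p. continuous_on circle p \<and> (\<forall>z\<in>circle. det (u z) = (p z)\<^sup>2 * z))"

text \<open>The quotient of the determinants is det(u* v), which has a continuous square root at
  distance at most 1; this root is absorbed into \<open>p\<close>.\<close>

lemma odd_det_near:
  assumes u: "u \<in> M_unitaries" and v: "v \<in> M_unitaries" and d: "M_dist u v \<le> 1" and "odd_det u"
  shows "odd_det v"
proof -
  obtain p where p: "continuous_on circle p" "\<And>z. z \<in> circle \<Longrightarrow> det (u z) = (p z)\<^sup>2 * z"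
    using \<open>odd_det u\<close> unfolding odd_det_def by auto
  let ?s = "\<lambda>z. csqrt (det (mat_adjoint (u z) ** v z))"
  have "det (v z) = (p z * ?s z)\<^sup>2 * z" if z: "z \<in> circle" for z
  proof -
    have "det (v z) = det (u z) * det (mat_adjoint (u z) ** v z)"
      using unitary_mat_cancel_left(2)[OF M_unitariesD(4)[OF u z], of "v z"] by (metis det_mul)
    then show ?thesis
      by (simp add: p(2)[OF z] power_mult_distrib)
  qed
  moreover have "continuous_on circle (\<lambda>z. p z * ?s z)"
    by (intro continuous_intros p(1) continuous_relative_sqrt(1)[OF u v d])
  ultimately show ?thesis
    unfolding odd_det_def by blast
qed

section \<open>Components and the invariance of the parity\<close>

lemma component_subset: "unitaries_component u \<subseteq> M_unitaries"
  unfolding unitaries_component_def using connected_component_of_subset_topspace topspace_M_unitaries_top by metis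

lemma component_close:
  assumes "u \<in> unitaries_component e" "v \<in> M_unitaries" "M_dist u v \<le> sqrt 2"
  shows "v \<in> unitaries_component e"
proof -
  have "connected_component_of M_unitaries_top u v"
    using assms component_subset by (intro unitaries_close_connected) auto
  then show ?thesis
    using assms(1) connected_component_of_trans by (fastforce simp: unitaries_component_def)
qed

lemma component_base: "u \<in> M_unitaries \<Longrightarrow> u \<in> unitaries_component u"
  by (simp add: unitaries_component_def connected_component_of_refl topspace_M_unitaries_top)

lemma odd_det_component:
  assumes v: "v \<in> unitaries_component w_fun"
  shows "odd_det v"
proof (rule ccontr)
  interpret Metric_space M_unitaries M_dist
    by (rule Metric_space_M_unitaries)
  \<comment> \<open>With \<open>R\<close> the identity or negation, the odd unitaries and the others
    form two open sets, so a connected set cannot meet both.\<close>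
  have open': "openin M_unitaries_top {u \<in> M_unitaries. R (odd_det u)}" for R :: "bool \<Rightarrow> bool"
    unfolding M_unitaries_top_def openin_mtopology
  proof (intro conjI allI impI)
    fix u assume u: "u \<in> {u \<in> M_unitaries. R (odd_det u)}"
    have "mball u 1 \<subseteq> {u \<in> M_unitaries. R (odd_det u)}"
    proof
      fix v assume "v \<in> mball u 1"
      then have v: "v \<in> M_unitaries" "M_dist u v \<le> 1" "M_dist v u \<le> 1"
        using M_dist_commute[of u v] by auto
      then have "odd_det v = odd_det u"
        using u odd_det_near[of u v] odd_det_near[of v u] by auto
      then show "v \<in> {u \<in> M_unitaries. R (odd_det u)}"
        using u v by simp
    qed
    then show "\<exists>r>0. mball u r \<subseteq> {u \<in> M_unitaries. R (odd_det u)}"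
      using zero_less_one by blast
  qed auto
  assume nv: "\<not> odd_det v"
  have "odd_det w_fun"
    unfolding odd_det_def
    by (intro exI[of _ "\<lambda>_. 1"]) (simp add: w_fun_def det_2)
  have "connectedin M_unitaries_top (unitaries_component w_fun)"
    unfolding unitaries_component_def by (rule connectedin_connected_component_of)
  then show False
    by (rule connectedinD[OF _ open'[of "\<lambda>x. x"] open'[of Not]])
      (use component_subset \<open>odd_det w_fun\<close> v nv component_base[OF w_fun_in_M_unitaries] in auto)
qed

section \<open>Isometries between components\<close>

definition orthogonal_unitaries :: "cmat_fun \<Rightarrow> cmat_fun \<Rightarrow> bool" where
  "orthogonal_unitaries u v \<longleftrightarrow> (\<forall>z\<in>circle. mat_adjoint (u z) ** v z + mat_adjoint (v z) ** u z = 0)"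

text \<open>For the eigenvalues a of u* v the relation says Re a = 0. Distance at most sqrt 2 from 1
  gives Re a >= 0, and from -1 gives Re a <= 0.\<close>

lemma orthogonal_unitaries_iff_dist:
  assumes u: "u \<in> M_unitaries" and v: "v \<in> M_unitaries"
  shows "orthogonal_unitaries u v \<longleftrightarrow> M_dist u v \<le> sqrt 2 \<and> M_dist (fun_scale (-1) u) v \<le> sqrt 2"
proof -
  have u': "fun_scale (-1) u \<in> M_unitaries"
    using u by (simp add: fun_scale_in_M_unitaries)
  have "mat_adjoint (u z) ** v z + mat_adjoint (v z) ** u z = 0 \<longleftrightarrow>
      cstar_norm (u z - v z) \<le> sqrt 2 \<and> cstar_norm (fun_scale (-1) u z - v z) \<le> sqrt 2"
    if z: "z \<in> circle" for z
  proof -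
    obtain P Q a b where PQ: "unitary_mat P" "unitary_mat Q" and ab: "cmod a = 1" "cmod b = 1"
      and uv: "u z = P ** diag2 1 1 ** Q" "v z = P ** diag2 a b ** Q"
      using M_unitaries_pair[OF u v z] by metis
    have W: "mat_adjoint (u z) ** v z = mat_adjoint Q ** diag2 a b ** Q"
      unfolding uv diag2_one matrix_mul_rid mat_adjoint_mult
      by (simp add: matrix_mul_assoc[symmetric] unitary_mat_cancel_left[OF PQ(1)])
    have "mat_adjoint (v z) ** u z = mat_adjoint (mat_adjoint (u z) ** v z)"
      by (simp add: mat_adjoint_mult)
    then have "mat_adjoint (u z) ** v z + mat_adjoint (v z) ** u z
        = mat_adjoint Q ** diag2 (a + cnj a) (b + cnj b) ** Q"
      by (simp only: W mat_adjoint_conj_diag2 diag2_sandwich_linear)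
    then have "mat_adjoint (u z) ** v z + mat_adjoint (v z) ** u z = 0 \<longleftrightarrow>
        max (cmod (a + cnj a)) (cmod (b + cnj b)) = 0"
      using cstar_norm_unitary_diag2[OF unitary_mat_adjoint[OF PQ(2)] PQ(2)] cstar_norm_eq_0 by metis
    also have "\<dots> \<longleftrightarrow> Re a = 0 \<and> Re b = 0"
      by (auto simp: complex_add_cnj max_def)
    also have "\<dots> \<longleftrightarrow> max (cmod (1 - a)) (cmod (1 - b)) \<le> sqrt 2 \<and> max (cmod (- 1 - a)) (cmod (- 1 - b)) \<le> sqrt 2"
      using cmod_diff_unit_le_iff[of 1 a "sqrt 2"] cmod_diff_unit_le_iff[of 1 b "sqrt 2"]
        cmod_diff_unit_le_iff[of "-1" a "sqrt 2"] cmod_diff_unit_le_iff[of "-1" b "sqrt 2"] ab by auto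
    also have "\<dots> \<longleftrightarrow> cstar_norm (u z - v z) \<le> sqrt 2 \<and> cstar_norm (fun_scale (-1) u z - v z) \<le> sqrt 2"
      using z unfolding fun_scale_def restrict_apply uv diag2_sandwich_linear(3)
      by (simp only: if_True sandwich_dist[OF PQ] mult_1_right)
    finally show ?thesis .
  qed
  then show ?thesis
    using u v u' unfolding orthogonal_unitaries_def by (auto simp: M_dist_le_iff M_unitaries_def)
qed

lemma mat_mult_minus: "(A :: complex^2^2) ** (- B) = - (A ** B)" "(- A) ** B = - (A ** B)" for B :: "complex^2^2"
  by (simp_all add: mat2_simps)

text \<open>Transposition reverses the product B A* C; three exchanges of neighbours, each with a
  sign, restore its order, so it is antisymmetric. The determinant of an antisymmetric 2x2 matrix is
  the square of its corner entry.\<close>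

lemma orthogonal_triple_det:
  assumes U: "unitary_mat A" "unitary_mat B" "unitary_mat C"
    and T: "transpose A = A" "transpose B = B" "transpose C = C"
    and orth: "mat_adjoint A ** B + mat_adjoint B ** A = 0" "mat_adjoint A ** C + mat_adjoint C ** A = 0"
      "mat_adjoint B ** C + mat_adjoint C ** B = 0"
  shows "det B * cnj (det A) * det C = ((B ** mat_adjoint A ** C) $ 1 $ 2)\<^sup>2"
proof -
  define X where "X = B ** mat_adjoint A ** C"
  have AB: "mat_adjoint A ** B = - (mat_adjoint B ** A)" and AC: "mat_adjoint A ** C = - (mat_adjoint C ** A)"
    and BC: "mat_adjoint B ** C = - (mat_adjoint C ** B)"
    using orth by (simp_all add: eq_neg_iff_add_eq_0)
  have "transpose (mat_adjoint A) = mat_adjoint A"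
    using T(1) by (simp add: vec_eq_iff transpose_def)
  then have "transpose X = C ** (mat_adjoint A ** B)"
    by (simp add: X_def matrix_transpose_mul T)
  also have "\<dots> = - (C ** mat_adjoint B ** A)"
    by (simp add: AB mat_mult_minus matrix_mul_assoc)
  also have "C ** mat_adjoint B = B ** (mat_adjoint B ** C) ** mat_adjoint B"
    by (simp add: unitary_mat_cancel_left[OF U(2)])
  also have "\<dots> = - (B ** mat_adjoint C)"
    unfolding BC by (simp add: mat_mult_minus matrix_mul_assoc unitary_mat_cancel_right[OF U(2)])
  also have "- (- (B ** mat_adjoint C) ** A) = B ** (mat_adjoint C ** A)"
    by (simp add: mat_mult_minus matrix_mul_assoc)
  also have "\<dots> = - X"
    using AC by (simp add: X_def mat_mult_minus flip: matrix_mul_assoc)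
  finally have X: "transpose X = - X" .
  have "X $ i $ j = - X $ j $ i" for i j
    using arg_cong[OF X, of "\<lambda>Y. Y $ j $ i"] by (simp add: transpose_def)
  from this[of 1 1] this[of 2 2] this[of 2 1] have "det X = (X $ 1 $ 2)\<^sup>2"
    by (simp add: det_2 power2_eq_square)
  moreover have "det (mat_adjoint A) = cnj (det A)"
    by (simp add: det_2 mult.commute)
  ultimately show ?thesis
    by (simp add: X_def det_mul)
qed

lemma fun_scale_fun_scale: "fun_scale c (fun_scale d u) = fun_scale (c * d) u"
  by (simp add: fun_scale_def fun_eq_iff mat2_simps)

lemma fun_scale_1: "u \<in> M_unitaries \<Longrightarrow> fun_scale 1 u = u"
  by (rule M_unitaries_eqI) (simp_all add: fun_scale_in_M_unitaries, simp add: fun_scale_def mat2_simps)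

lemma isometry_antipode:
  assumes f: "surjective_isometry M_dist (unitaries_component e) M_dist (unitaries_component w) f"
    and x: "x \<in> unitaries_component e"
  shows "fun_scale (-1) x \<in> unitaries_component e" "f (fun_scale (-1) x) = fun_scale (-1) (f x)"
proof -
  \<comment> \<open>This angle gives c^6 = -1 and |c^2 - 1| = 1, and 2 Re c = sqrt 3 is the
    coefficient of the recursion below.\<close>
  define c where "c = cis (pi / 6)"
  define X where "X k = fun_scale (c ^ k) x" for k :: nat
  have c: "cmod c = 1" "Re c = sqrt 3 / 2"
    by (simp_all add: c_def cos_30)
  have ck: "cmod (c ^ k) = 1" for k
    using c by (simp add: norm_power)
  have c6: "c ^ 6 = -1"
    by (simp add: c_def Complex.DeMoivre)
  have xM: "x \<in> M_unitaries"
    using x component_subset by blast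
  have r: "(cmod (c - 1))\<^sup>2 = 2 - sqrt 3"
    using cmod_diff_unit[of c 1] c by simp
  have "(cmod (c\<^sup>2 - 1))\<^sup>2 = 1\<^sup>2"
    using cmod_diff_unit[of "c\<^sup>2" 1] ck[of 2] by (simp add: c_def Complex.DeMoivre cos_60)
  then have c2: "cmod (c\<^sup>2 - 1) = 1"
    by (subst (asm) power_eq_iff_eq_base) auto
  have XM: "X k \<in> M_unitaries" for k
    unfolding X_def by (intro fun_scale_in_M_unitaries xM ck)
  have dX: "M_dist (X k) (X (k + n)) \<le> cmod (c ^ n - 1)" for k n
  proof -
    have "cmod (c ^ k - c ^ (k + n)) = cmod (c ^ k) * cmod (1 - c ^ n)"
      by (simp add: power_add right_diff_distrib flip: norm_mult)
    then show ?thesis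
      using M_dist_fun_scale[OF xM ck[of k] ck[of "k + n"]] ck[of k]
      by (simp add: X_def norm_minus_commute)
  qed
  have X: "X k \<in> unitaries_component e" for k
  proof (induction k)
    case 0
    then show ?case
      using x by (simp add: X_def fun_scale_1 xM)
  next
    case (Suc k)
    have "(cmod (c - 1))\<^sup>2 \<le> (sqrt 2)\<^sup>2"
      by (simp add: r)
    then have "cmod (c - 1) \<le> sqrt 2"
      by (rule power2_le_imp_le) simp
    then show ?case
      using component_close[OF Suc XM[of "Suc k"]] dX[of k 1] by simp
  qed
  have fim: "f ` unitaries_component e = unitaries_component w"
    and fd: "\<And>p q. p \<in> unitaries_component e \<Longrightarrow> q \<in> unitaries_component e \<Longrightarrow> M_dist (f p) (f q) = M_dist p q"
    using f by (auto simp: surjective_isometry_def)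
  have fM: "f p \<in> M_unitaries" if "p \<in> unitaries_component e" for p
    using that fim component_subset by blast
  have rec: "f (X k) z + f (X (k + 2)) z = mat_scale (of_real (sqrt 3)) (f (X (k + 1)) z)"
    if z: "z \<in> circle" for k z
  proof (rule isolated_midpoint_imp_linear[OF fM[OF X] fM[OF X] fM[OF X] _ _ z])
    show "M_dist (f (X k)) (f (X (k + 2))) \<le> 1"
      using dX[of k 2] c2 by (simp add: fd X)
  next
    fix p assume p: "p \<in> M_unitaries" "(M_dist p (f (X k)))\<^sup>2 \<le> 2 - sqrt 3"
      "(M_dist p (f (X (k + 2))))\<^sup>2 \<le> 2 - sqrt 3"
    \<comment> \<open>A competitor is close enough to \<open>f (X k)\<close> to lie in the target
      component, so surjectivity pulls it back to a midpoint in the source, where it is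
      unique.\<close>
    have "2 - sqrt 3 \<le> (sqrt 2)\<^sup>2"
      by simp
    then have "(M_dist p (f (X k)))\<^sup>2 \<le> (sqrt 2)\<^sup>2"
      by (rule order_trans[OF p(2)])
    then have "M_dist (f (X k)) p \<le> sqrt 2"
      unfolding M_dist_commute[of _ p] by (rule power2_le_imp_le) simp
    then have "p \<in> unitaries_component w"
      using component_close[of "f (X k)" w p] fim X p(1) by blast
    then obtain q where q: "q \<in> unitaries_component e" "p = f q"
      using fim by blast
    have le: "M_dist q (X k) \<le> cmod (c - 1)" "M_dist q (X (k + 2)) \<le> cmod (c - 1)"
      using p(2,3)[unfolded q(2) fd[OF q(1) X] r[symmetric]]
      by (auto intro: power2_le_imp_le[OF _ norm_ge_zero])
    have "q = fun_scale c (X k)"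
    proof (rule unique_midpoint)
      show "M_dist q (fun_scale (c\<^sup>2) (X k)) \<le> cmod (c - 1)"
        using le(2) by (simp add: X_def fun_scale_fun_scale power2_eq_square mult_ac)
      show "0 < Re c"
        unfolding c(2) by simp
    qed (use le q component_subset XM c in auto)
    then show "p = f (X (k + 1))"
      by (simp add: q(2) X_def fun_scale_fun_scale)
  qed
  have X0: "X 0 = x" and X6: "X 6 = fun_scale (-1) x"
    using c6 by (simp_all add: X_def fun_scale_1 xM)
  show neg: "fun_scale (-1) x \<in> unitaries_component e"
    using X[of 6] by (simp only: X6)
  show "f (fun_scale (-1) x) = fun_scale (-1) (f x)"
  proof (rule M_unitaries_eqI[OF fM[OF neg]])
    show "fun_scale (-1) (f x) \<in> M_unitaries"
      using fM[OF x] by (simp add: fun_scale_in_M_unitaries)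
    fix z assume z: "z \<in> circle"
    have "f (X 6) z $ i $ j = - f x z $ i $ j" for i j
    proof -
      define a where "a k = f (X k) z $ i $ j" for k
      define s where "s = complex_of_real (sqrt 3)"
      have "s * s = of_real (sqrt 3 * sqrt 3)"
        unfolding s_def by (rule of_real_mult[symmetric])
      then have ss: "s * s = 3"
        by simp
      \<comment> \<open>The characteristic roots of this recursion are exp(i pi/6) and its
        conjugate, so six steps change the sign.\<close>
      have a: "a k + a (k + 2) = s * a (k + 1)" for k
        using arg_cong[OF rec[OF z, of k], of "\<lambda>A. A $ i $ j"] by (simp add: a_def s_def)
      have a': "a 0 + a 2 = s * a 1" "a 1 + a 3 = s * a 2" "a 2 + a 4 = s * a 3"
        "a 3 + a 5 = s * a 4" "a 4 + a 6 = s * a 5"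
        using a[of 0] a[of 1] a[of 2] a[of 3] a[of 4] by (simp_all add: numeral_eq_Suc)
      have "a 2 = s * a 1 - a 0"
        using a' by algebra
      moreover from this have "a 3 = 2 * a 1 - s * a 0"
        using a' ss by algebra
      ultimately have "a 4 = s * a 1 - 2 * a 0" "a 5 = a 1 - s * a 0"
        using a' ss by algebra+
      then have "a 6 = - a 0"
        using a' ss by algebra
      then show ?thesis
        by (simp add: a_def X0)
    qed
    then show "f (fun_scale (-1) x) z = fun_scale (-1) (f x) z"
      using z by (simp add: X6 fun_scale_def vec_eq_iff)
  qed
qed

lemma const_in_M_unitaries:
  assumes "transpose A = A" "unitary_mat A"
  shows "(\<lambda>z\<in>circle. A) \<in> M_unitaries"
  by (rule M_unitariesI) (use assms in simp_all)

text \<open>Orthogonality is read off the distances of \<open>v\<close> from \<open>u\<close> and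
  from its antipode; since \<open>f\<close> respects antipodes, both are preserved.\<close>

lemma isometry_orthogonal_unitaries:
  assumes f: "surjective_isometry M_dist (unitaries_component e) M_dist (unitaries_component w) f"
    and u: "u \<in> unitaries_component e" and v: "v \<in> unitaries_component e" and uv: "orthogonal_unitaries u v"
  shows "orthogonal_unitaries (f u) (f v)"
proof -
  have M: "u \<in> M_unitaries" "v \<in> M_unitaries" "f u \<in> M_unitaries" "f v \<in> M_unitaries"
    using u v f component_subset[of e] component_subset[of w] by (auto simp: surjective_isometry_def)
  note neg = isometry_antipode[OF f u]
  have "M_dist (f u) (f v) = M_dist u v" "M_dist (f (fun_scale (-1) u)) (f v) = M_dist (fun_scale (-1) u) v"
    using f u v neg(1) by (auto simp: surjective_isometry_def)
  then show ?thesis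
    using uv by (simp add: orthogonal_unitaries_iff_dist M neg(2))
qed

theorem mainTheorem6:
  shows "\<not> (\<exists>\<Delta>. surjective_isometry
                 M_dist (unitaries_component M_unit)
                 M_dist (unitaries_component w_fun) \<Delta>)"
proof
  assume "\<exists>\<Delta>. surjective_isometry M_dist (unitaries_component M_unit) M_dist (unitaries_component w_fun) \<Delta>"
  then obtain f where f: "surjective_isometry M_dist (unitaries_component M_unit) M_dist (unitaries_component w_fun) f"
    by blast
  \<comment> \<open>\<open>S\<close> and \<open>T\<close> are i times the two real Pauli matrices;
    they are symmetric, and together with the identity they are pairwise orthogonal.\<close>
  define S :: "complex^2^2" where "S = diag2 \<i> (- \<i>)"
  define T :: "complex^2^2" where "T = (\<chi> i j. if i = j then 0 else \<i>)"
  define s t :: cmat_fun where "s = (\<lambda>z\<in>circle. S)" and "t = (\<lambda>z\<in>circle. T)"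
  have sM: "s \<in> M_unitaries" and tM: "t \<in> M_unitaries"
    unfolding s_def t_def
    by (rule const_in_M_unitaries; simp add: S_def T_def unitary_mat_def mat2_simps transpose_def)+
  have orth: "orthogonal_unitaries M_unit s" "orthogonal_unitaries M_unit t" "orthogonal_unitaries s t"
    unfolding orthogonal_unitaries_def
    by (simp_all add: s_def t_def M_unit_def S_def T_def mat2_simps)
  \<comment> \<open>Orthogonality bounds the distance to the unit by sqrt 2, which places the
    constants in its component.\<close>
  have comp: "M_unit \<in> unitaries_component M_unit" "s \<in> unitaries_component M_unit" "t \<in> unitaries_component M_unit"
    using component_base[OF M_unit_in_M_unitaries] component_close[of M_unit M_unit]
      orth(1,2) sM tM by (auto simp: orthogonal_unitaries_iff_dist M_unit_in_M_unitaries)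
  define a b c where "a = f M_unit" and "b = f s" and "c = f t"
  have abc: "a \<in> unitaries_component w_fun" "b \<in> unitaries_component w_fun" "c \<in> unitaries_component w_fun"
    using f comp unfolding a_def b_def c_def by (auto simp: surjective_isometry_def)
  then have M: "a \<in> M_unitaries" "b \<in> M_unitaries" "c \<in> M_unitaries"
    using component_subset by blast+
  have orth': "orthogonal_unitaries a b" "orthogonal_unitaries a c" "orthogonal_unitaries b c"
    unfolding a_def b_def c_def by (intro isometry_orthogonal_unitaries[OF f] comp orth)+
  obtain pa pb pc where p: "continuous_on circle pa" "continuous_on circle pb" "continuous_on circle pc"
    and det: "\<And>z. z \<in> circle \<Longrightarrow> det (a z) = (pa z)\<^sup>2 * z" "\<And>z. z \<in> circle \<Longrightarrow> det (b z) = (pb z)\<^sup>2 * z"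
      "\<And>z. z \<in> circle \<Longrightarrow> det (c z) = (pc z)\<^sup>2 * z"
    using abc[THEN odd_det_component] unfolding odd_det_def by metis
  \<comment> \<open>The determinant of B A* C is g^2 z by parity, as z cnj z = 1, and q^2 by
    antisymmetry, so q / g is a continuous square root of z.\<close>
  define g q where "g z = pb z * cnj (pa z) * pc z" and "q z = (b z ** mat_adjoint (a z) ** c z) $ 1 $ 2" for z
  have nz: "g z \<noteq> 0" if z: "z \<in> circle" for z
  proof -
    have "det (u z) \<noteq> 0" if "u \<in> M_unitaries" for u
      using M_unitariesD(4)[OF that z] unfolding unitary_mat_def by (metis det_I det_mul mult_zero_right zero_neq_one)
    from M[THEN this] show ?thesis
      using det[OF z] by (simp add: g_def)
  qed
  have "(q z / g z)\<^sup>2 = z" if z: "z \<in> circle" for z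
  proof -
    have "(q z)\<^sup>2 = det (b z) * cnj (det (a z)) * det (c z)"
      unfolding q_def using orth' z unfolding orthogonal_unitaries_def
      by (intro orthogonal_triple_det[symmetric] M_unitariesD M) auto
    also have "\<dots> = (g z)\<^sup>2 * z * (z * cnj z)"
      by (simp add: det[OF z] g_def power_mult_distrib)
    finally show ?thesis
      using nz[OF z] unit_mult_cnj[of z] z by (simp add: power_divide)
  qed
  moreover have "continuous_on circle (\<lambda>z. q z / g z)"
    unfolding q_def g_def by (intro continuous_intros p M_unitariesD(2) M) (use nz in \<open>simp add: g_def\<close>)
  ultimately show False
    by (rule no_continuous_sqrt_on_circle[rotated])
qed

end
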